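(* Let $d\ge1$ be a constant (independent of $p_H$). Under the ChainMatch(d) policy $\mathcal{C}(d)$ and in steady-state, the average waiting time $w_H^{\mathcal{C}(d)}$ of $H$ agents satisfies $$\lim_{p_H\to0}p_H\,w_H^{\mathcal{C}(d)}\le\frac{\ln\left(\frac{\lambda_H}{\lambda_E(1-(1-p_E)^d)}+1\right)}{\lambda_H}.$$
   Context: Model: agents of two types $H$ (hard-to-match) and $E$ (easy-to-match) arrive to a market according to independent Poisson processes with rates $\lambda_H,\lambda_E>0$. Each agent owns an item; an agent of type $T\in\{H,E\}$ finds the item of any other agent compatible with probability $p_T$, independently over all ordered pairs; there is a directed edge from $i$ to $j$ if $j$ finds $i$'s item compatible. Here $p_E\in(0,1]$ is a fixed constant and $p_H\in(0,1)$ is a parameter tending to $0$. A waiting agent leaves only when matched, i.e. when she receives a compatible item. Policy ChainMatch(d) ($\mathcal{C}(d)$), with $d$ a positive integer: the market starts with $d$ altruistic agents, who give an item without requiring one; at all times there are exactly $d$ bridge agents (an altruistic agent who has not yet given, or an agent who has received an item but not yet given hers). When a new agent $i_1$ arrives: if no bridge agent has an edge to $i_1$, then $i_1$ joins the market and waits. Otherwise one of the bridge agents with an edge to $i_1$ is chosen uniformly at random and gives her item to $i_1$ (ceasing to be a bridge agent), starting a chain-segment. The chain-segment advances instantaneously by local search: if the current last agent has an edge to at least one waiting agent not already in the chain-segment, one of these is selected at random, with $H$ agents favored over $E$ agents, is matched by the last agent and becomes the new last agent; this is repeated until the last agent has no edge to a remaining waiting agent. All agents of the chain-segment leave the market, and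 the last one becomes a bridge agent. The numbers $[H_t,E_t]$ of waiting (non-bridge) $H$ and $E$ agents form a positive recurrent continuous-time Markov chain: since each edge is examined at most once, edges may be revealed only when examined. $[H^{\mathcal{C}(d)},E^{\mathcal{C}(d)}]$ has its stationary distribution, and by Little's law the steady-state average waiting time of $H$ agents is $w_H^{\mathcal{C}(d)}=\mathbb{E}[H^{\mathcal{C}(d)}]/\lambda_H$. *)

theory Defs
  imports "HOL-Probability.Probability"
begin

datatype agent_type = Hard | Easy

(* compat pH pE T: probability that an agent of type T finds a given item compatible.
   It depends on the type of the receiver only, not on that of the giver. *)
fun compat :: "real \<Rightarrow> real \<Rightarrow> agent_type \<Rightarrow> real" where
  "compat pH pE Hard = pH"
| "compat pH pE Easy = pE"

(* Reveals n potential edges, present independently with probability p each, and reports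
   whether at least one of them is present. No edge is ever examined twice: a waiting agent
   has no edge from the bridge agents examined on her arrival, and the end of a chain-segment
   becomes a bridge agent only after all her edges to waiting agents were found to be absent.
   Bridge agents are thus only examined again with respect to later arrivals. *)
definition some_edge :: "nat \<Rightarrow> real \<Rightarrow> bool pmf" where
  "some_edge n p =
     map_pmf (\<lambda>edge. \<exists>i<n. edge i) (Pi_pmf {..<n} False (\<lambda>_. bernoulli_pmf p))"

lemma some_edge_0 [simp]: "some_edge 0 p = return_pmf False"
  by (simp add: some_edge_def)

declare bind_pmf_cong [fundef_cong]

(* States are pairs (h, e) of the numbers of waiting H and E agents. chain_segment (h, e) is
   the law of the numbers still waiting once the segment has stopped, where (h, e) counts the
   waiting agents outside the segment. Waiting agents of the same type are exchangeable, so
   the random choice among the reachable ones of that type does not affect the counts. *)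
function chain_segment :: "real \<Rightarrow> real \<Rightarrow> nat \<times> nat \<Rightarrow> (nat \<times> nat) pmf" where
  "chain_segment pH pE (h, e) =
     bind_pmf (some_edge h pH) (\<lambda>edge_to_H.
     bind_pmf (some_edge e pE) (\<lambda>edge_to_E.
       if edge_to_H then chain_segment pH pE (h - 1, e)
       else if edge_to_E then chain_segment pH pE (h, e - 1)
       else return_pmf (h, e)))"
  by pat_completeness auto

termination
proof (relation "Wellfounded.measure (\<lambda>(pH, pE, h, e). h + e)", goal_cases)
  case (2 pH pE h e x xa)
  then show ?case by (cases h) auto
next
  case (3 pH pE h e x xa)
  then show ?case by (cases e) auto
qed simp

declare chain_segment.simps [simp del]

fun join :: "agent_type \<Rightarrow> nat \<times> nat \<Rightarrow> nat \<times> nat" where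
  "join Hard (h, e) = (h + 1, e)"
| "join Easy (h, e) = (h, e + 1)"

(* Law of the state after the arrival of an agent of type T, with d bridge agents present. *)
definition arrival :: "real \<Rightarrow> real \<Rightarrow> nat \<Rightarrow> agent_type \<Rightarrow> nat \<times> nat \<Rightarrow> (nat \<times> nat) pmf" where
  "arrival pH pE d T s =
     bind_pmf (some_edge d (compat pH pE T)) (\<lambda>edge_from_bridge.
       if edge_from_bridge then chain_segment pH pE s else return_pmf (join T s))"

(* Infinitesimal generator (Q-matrix) of the chain of waiting numbers under ChainMatch(d).
   An arrival may leave the state unchanged, namely when the segment consists of the arriving
   agent only; such arrivals cancel on the diagonal, and every row sums to 0. *)
definition chainmatch_generator ::
    "real \<Rightarrow> real \<Rightarrow> real \<Rightarrow> real \<Rightarrow> nat \<Rightarrow> nat \<times> nat \<Rightarrow> nat \<times> nat \<Rightarrow> real" where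
  "chainmatch_generator lamH lamE pH pE d x y =
     lamH * (pmf (arrival pH pE d Hard x) y - of_bool (x = y)) +
     lamE * (pmf (arrival pH pE d Easy x) y - of_bool (x = y))"

(* Invariance pi Q = 0. *)
definition stationary_distribution :: "('s \<Rightarrow> 's \<Rightarrow> real) \<Rightarrow> 's pmf \<Rightarrow> bool" where
  "stationary_distribution Q \<pi> \<longleftrightarrow> (\<forall>y. ((\<lambda>x. pmf \<pi> x * Q x y) has_sum 0) UNIV)"

(* Little's law: mean number of waiting H agents in steady state divided by their arrival rate.
   The mean is a nonnegative extended integral, so an infinite one would not be read as 0. *)
definition waiting_time_H :: "real \<Rightarrow> (nat \<times> nat) pmf \<Rightarrow> ennreal" where
  "waiting_time_H lamH \<pi> = (\<integral>\<^sup>+ s. of_nat (fst s) \<partial>measure_pmf \<pi>) / ennreal lamH"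

end

theory Submission imports Defs "HOL-Real_Asymp.Real_Asymp" begin

text \<open>
  Write \<open>a_h = (1 - p)^h\<close>, \<open>\<alpha> = lamH / (lamH + lamE)\<close> and \<open>\<beta> = 1 - \<alpha>\<close>. Whenever an agent has
  been matched, she reaches a waiting hard agent with probability \<open>1 - a_h\<close>. Two test functions
  have nearly explicit drift under the jump chain: \<open>e - (\<Sum>k\<le>h. a_k / (1 - a_k))\<close>, which gives
  \<open>E[1 / (1 - a_(h+1))] \<le> 1 / (\<alpha> (1 - p)^d)\<close>, and \<open>(\<Sum>k\<le>h. a_k) - e (1 - a_h)\<close>, which gives
  \<open>E[1 - a_h] \<le> \<alpha> + O(p)\<close>. With \<open>y = 1 - a_(h+1)\<close> the two bounds say
  \<open>E[(y - \<alpha>)^2 / y] = E[y] - 2 \<alpha> + \<alpha>^2 E[1 / y] \<rightarrow> 0\<close>, so \<open>a_h\<close> concentrates at \<open>\<beta>\<close>. A cubic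
  Lyapunov function bounds \<open>E[(p h)^2]\<close> uniformly, hence \<open>p E[h] \<rightarrow> - ln \<beta> = ln (lamH / lamE + 1)\<close>.
  The limit thus exists and does not depend on \<open>d\<close>; the claimed bound is weaker.
\<close>

section \<open>Laws of revealed edges and finite support of transitions\<close>

lemma some_edge_eq_bernoulli:
  assumes "0 \<le> p" "p \<le> 1"
  shows "some_edge n p = bernoulli_pmf (1 - (1 - p) ^ n)"
proof -
  have r: "1 - (1 - p) ^ n \<in> {0..1}"
    using assms by (simp add: power_le_one)
  have "pmf (some_edge n p) False =
      measure (Pi_pmf {..<n} False (\<lambda>_. bernoulli_pmf p)) (Pi {..<n} (\<lambda>_. {False}))"
    unfolding some_edge_def pmf_map by (rule arg_cong[where f = "measure_pmf.prob _"]) auto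
  also have "\<dots> = (1 - p) ^ n"
    using assms by (subst measure_Pi_pmf_Pi) (auto simp: measure_pmf_single)
  finally have F: "pmf (some_edge n p) False = (1 - p) ^ n" .
  then have T: "pmf (some_edge n p) True = 1 - (1 - p) ^ n"
    by (simp add: pmf_False_conv_True)
  show ?thesis
    using r F T by (intro pmf_eqI) (case_tac i; simp)
qed

lemma expectation_bind_bernoulli:
  fixes f :: "'a \<Rightarrow> real"
  assumes "0 \<le> r" "r \<le> 1" "finite (set_pmf (M True))" "finite (set_pmf (M False))"
  shows "measure_pmf.expectation (bernoulli_pmf r \<bind> M) f =
    r * measure_pmf.expectation (M True) f + (1 - r) * measure_pmf.expectation (M False) f"
proof -
  have "finite (set_pmf (M b))" for b
    using assms by (cases b) auto
  then show ?thesis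
    using assms by (subst pmf_expectation_bind[where A = UNIV]) (auto simp: UNIV_bool)
qed

text \<open>A segment only removes waiting agents. The resulting finite support makes every real
  test function integrable under a single transition, whatever its growth.\<close>

lemma set_chain_segment:
  "set_pmf (chain_segment pH pE (h, e)) \<subseteq> {..h} \<times> {..e}"
proof (induction "h + e" arbitrary: h e rule: less_induct)
  case less
  have H: "set_pmf (chain_segment pH pE (h - 1, e)) \<subseteq> {..h} \<times> {..e}" if "h > 0"
    using less[of "h - 1" e] that by fastforce
  have E: "set_pmf (chain_segment pH pE (h, e - 1)) \<subseteq> {..h} \<times> {..e}" if "e > 0"
    using less[of h "e - 1"] that by fastforce
  show ?case
    using H E by (cases "h = 0"; cases "e = 0")
      (subst chain_segment.simps; auto simp: bind_return_pmf split: if_splits)+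
qed

lemma finite_set_chain_segment: "finite (set_pmf (chain_segment pH pE s))"
  by (cases s) (auto intro: finite_subset[OF set_chain_segment])

lemma finite_set_arrival: "finite (set_pmf (arrival pH pE d T s))"
  by (auto simp: arrival_def intro!: finite_set_chain_segment)

section \<open>The chain embedded at arrivals and its invariant laws\<close>

text \<open>Transition law of the discrete chain observed at arrivals, where \<open>\<alpha>\<close>
  is the probability that the next arrival is hard.\<close>

definition jump_kernel ::
    "real \<Rightarrow> real \<Rightarrow> real \<Rightarrow> nat \<Rightarrow> nat \<times> nat \<Rightarrow> (nat \<times> nat) pmf" where
  "jump_kernel \<alpha> pH pE d s =
     bernoulli_pmf \<alpha> \<bind> (\<lambda>hard. arrival pH pE d (if hard then Hard else Easy) s)"

lemma finite_set_jump_kernel: "finite (set_pmf (jump_kernel \<alpha> pH pE d s))"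
  by (auto simp: jump_kernel_def intro!: finite_set_arrival)

text \<open>Puts a mixture into the form of an unordered sum over states, in which stationarity is
  stated.\<close>

lemma has_sum_pmf_bind:
  "((\<lambda>x. pmf M x * pmf (K x) y) has_sum pmf (M \<bind> K) y) UNIV"
proof -
  let ?f = "\<lambda>x. pmf M x * pmf (K x) y"
  have abs: "Infinite_Set_Sum.abs_summable_on ?f UNIV"
    by (rule abs_summable_on_comparison_test[where g = "pmf M"])
      (auto simp: mult_left_le pmf_le_1 pmf_abs_summable abs_mult)
  then have "(\<lambda>x. norm (?f x)) summable_on UNIV"
    by (rule abs_summable_equivalent[where f = ?f, THEN iffD2])
  then have "?f summable_on UNIV"
    by (rule abs_summable_summable)
  then have "(?f has_sum infsetsum ?f UNIV) UNIV"
    unfolding infsetsum_infsum[OF abs] by (rule has_sum_infsum)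
  moreover have "pmf (M \<bind> K) y = (\<integral>x. pmf M x * pmf (K x) y \<partial>count_space UNIV)"
    unfolding pmf_bind by (subst measure_pmf_eq_density) (simp add: integral_density)
  ultimately show ?thesis
    by (simp add: infsetsum_def)
qed

text \<open>The generator is \<open>lamH + lamE\<close> times the jump kernel minus the identity,
  because the total arrival rate is the same in all states. Dividing the balance equation by this
  rate gives invariance.\<close>

lemma stationary_distribution_imp_invariant:
  assumes "lamH > 0" "lamE > 0"
    and st: "stationary_distribution (chainmatch_generator lamH lamE pH pE d) \<pi>"
  shows "\<pi> \<bind> jump_kernel (lamH / (lamH + lamE)) pH pE d = \<pi>"
proof (rule pmf_eqI)
  fix y
  define \<alpha> where "\<alpha> = lamH / (lamH + lamE)"
  let ?K = "jump_kernel \<alpha> pH pE d"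
  have \<alpha>: "0 \<le> \<alpha>" "\<alpha> \<le> 1" "(lamH + lamE) * \<alpha> = lamH" "(lamH + lamE) * (1 - \<alpha>) = lamE"
    using assms by (auto simp: \<alpha>_def field_simps)
  have K: "pmf (?K x) y = \<alpha> * pmf (arrival pH pE d Hard x) y + (1 - \<alpha>) * pmf (arrival pH pE d Easy x) y" for x
    unfolding jump_kernel_def pmf_bind using \<alpha> by simp
  have "((\<lambda>x. pmf \<pi> x * pmf (return_pmf x) y) has_sum pmf (\<pi> \<bind> return_pmf) y) UNIV"
    by (rule has_sum_pmf_bind)
  then have 1: "((\<lambda>x. pmf \<pi> x * of_bool (x = y)) has_sum pmf \<pi> y) UNIV"
    by (simp add: bind_return_pmf' pmf_return indicator_def of_bool_def)
  have Q: "pmf \<pi> x * chainmatch_generator lamH lamE pH pE d x y =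
      (lamH + lamE) * (pmf \<pi> x * pmf (?K x) y - pmf \<pi> x * of_bool (x = y))" for x
  proof -
    have "(lamH + lamE) * pmf (?K x) y = lamH * pmf (arrival pH pE d Hard x) y + lamE * pmf (arrival pH pE d Easy x) y"
      unfolding K by (simp only: distrib_left mult.assoc[symmetric] \<alpha>)
    then show ?thesis
      unfolding chainmatch_generator_def by (simp add: algebra_simps) algebra
  qed
  have "((\<lambda>x. (lamH + lamE) * (pmf \<pi> x * pmf (?K x) y + - (pmf \<pi> x * of_bool (x = y))))
      has_sum (lamH + lamE) * (pmf (\<pi> \<bind> ?K) y + - pmf \<pi> y)) UNIV"
    by (intro has_sum_cmult_right has_sum_add has_sum_pmf_bind)
      (use 1 in \<open>simp add: has_sum_uminus\<close>)
  moreover have "((\<lambda>x. pmf \<pi> x * chainmatch_generator lamH lamE pH pE d x y) has_sum 0) UNIV"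
    using st unfolding stationary_distribution_def by blast
  ultimately have "(lamH + lamE) * (pmf (\<pi> \<bind> ?K) y - pmf \<pi> y) = 0"
    unfolding Q add_uminus_conv_diff by (rule has_sum_unique)
  then show "pmf (\<pi> \<bind> jump_kernel (lamH / (lamH + lamE)) pH pE d) y = pmf \<pi> y"
    using assms by (simp add: \<alpha>_def)
qed

section \<open>Stationary means from drift inequalities\<close>

text \<open>In stationarity the mean one-step change of \<open>f\<close> should vanish, which turns
  the drift inequality into a bound on the mean of \<open>g\<close>. As \<open>f\<close> need not be
  integrable under \<open>\<pi>\<close>, the argument runs on truncations of \<open>f + B\<close>
  and ends with monotone convergence.\<close>

lemma foster_bound:
  fixes f g :: "'a \<Rightarrow> real"
  assumes inv: "\<pi> \<bind> K = \<pi>"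
    and fin: "\<And>s. finite (set_pmf (K s))"
    and lower: "\<And>s. - B \<le> f s" and g: "\<And>s. 0 \<le> g s" and "0 \<le> b"
    and drift: "\<And>s. measure_pmf.expectation (K s) f \<le> f s - g s + b"
  shows "integrable (measure_pmf \<pi>) g \<and> measure_pmf.expectation \<pi> g \<le> b"
proof -
  define F where "F n s = min (f s + B) (real n)" for n :: nat and s
  have F0: "0 \<le> F n s" and Fn: "F n s \<le> real n" for n s
    using lower[of s] by (auto simp: F_def)
  \<comment> \<open>Below level \<open>n\<close> the drift inequality survives truncation of the
    successor value. From level \<open>n\<close> on the truncated function is maximal and cannot
    increase, so \<open>g\<close> is left out there.\<close>
  have step: "(\<integral>\<^sup>+t. ennreal (F n t) \<partial>K s) + ennreal (g s) * indicator {s. f s + B < real n} s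
      \<le> ennreal (F n s) + ennreal b" for n s
  proof -
    have int: "integrable (K s) h" for h :: "'a \<Rightarrow> real"
      by (rule integrable_measure_pmf_finite[OF fin])
    have eq: "(\<integral>\<^sup>+t. ennreal (F n t) \<partial>K s) = ennreal (measure_pmf.expectation (K s) (F n))"
      by (rule nn_integral_eq_integral) (auto simp: F0 int)
    have E0: "0 \<le> measure_pmf.expectation (K s) (F n)"
      by (rule integral_nonneg_AE) (simp add: F0)
    show ?thesis
    proof (cases "f s + B < real n")
      case True
      have "measure_pmf.expectation (K s) (F n) \<le> measure_pmf.expectation (K s) (\<lambda>t. f t + B)"
        by (intro integral_mono int) (simp add: F_def)
      also have "\<dots> = measure_pmf.expectation (K s) f + B"
        using int by simp
      finally have "measure_pmf.expectation (K s) (F n) + g s \<le> F n s + b"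
        using drift[of s] True by (simp add: F_def)
      then show ?thesis
        using True E0 g F0 \<open>0 \<le> b\<close> by (simp add: eq flip: ennreal_plus)
    next
      case False
      have "measure_pmf.expectation (K s) (F n) \<le> measure_pmf.expectation (K s) (\<lambda>t. real n)"
        by (intro integral_mono int) (simp add: Fn)
      then have "measure_pmf.expectation (K s) (F n) \<le> F n s + b"
        using False \<open>0 \<le> b\<close> by (simp add: F_def)
      then show ?thesis
        using False F0 \<open>0 \<le> b\<close> by (simp add: eq flip: ennreal_plus)
    qed
  qed
  have trunc: "(\<integral>\<^sup>+s. ennreal (g s) * indicator {s. f s + B < real n} s \<partial>\<pi>) \<le> ennreal b" for n
  proof -
    have "(\<integral>\<^sup>+s. ennreal (F n s) \<partial>\<pi>) = (\<integral>\<^sup>+s. \<integral>\<^sup>+t. ennreal (F n t) \<partial>K s \<partial>\<pi>)"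
      by (metis inv nn_integral_bind_pmf)
    then have "(\<integral>\<^sup>+s. ennreal (F n s) \<partial>\<pi>) + (\<integral>\<^sup>+s. ennreal (g s) * indicator {s. f s + B < real n} s \<partial>\<pi>)
        = (\<integral>\<^sup>+s. (\<integral>\<^sup>+t. ennreal (F n t) \<partial>K s) + ennreal (g s) * indicator {s. f s + B < real n} s \<partial>\<pi>)"
      by (simp add: nn_integral_add)
    also have "\<dots> \<le> (\<integral>\<^sup>+s. ennreal (F n s) + ennreal b \<partial>\<pi>)"
      by (intro nn_integral_mono step)
    also have "\<dots> = (\<integral>\<^sup>+s. ennreal (F n s) \<partial>\<pi>) + ennreal b"
      by (simp add: nn_integral_add measure_pmf.emeasure_space_1[simplified])
    finally have le: "(\<integral>\<^sup>+s. ennreal (F n s) \<partial>\<pi>) + (\<integral>\<^sup>+s. ennreal (g s) * indicator {s. f s + B < real n} s \<partial>\<pi>)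
        \<le> (\<integral>\<^sup>+s. ennreal (F n s) \<partial>\<pi>) + ennreal b" .
    \<comment> \<open>The truncated mean is at most \<open>n\<close>, hence finite, and can be
      cancelled from both sides of \<open>le\<close>.\<close>
    have "(\<integral>\<^sup>+s. ennreal (F n s) \<partial>\<pi>) \<le> (\<integral>\<^sup>+s. ennreal (real n) \<partial>\<pi>)"
      by (intro nn_integral_mono ennreal_leI Fn)
    also have "\<dots> < top"
      by (simp add: measure_pmf.emeasure_space_1[simplified])
    finally show ?thesis
      using le by (auto simp: ennreal_add_left_cancel_le)
  qed
  have "(\<integral>\<^sup>+s. ennreal (g s) \<partial>\<pi>) = (\<integral>\<^sup>+s. (SUP n. ennreal (g s) * indicator {s. f s + B < real n} s) \<partial>\<pi>)"
  proof (intro nn_integral_cong antisym)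
    fix s
    obtain n where "f s + B < real n"
      using reals_Archimedean2 by blast
    then have "ennreal (g s) = ennreal (g s) * indicator {s. f s + B < real n} s"
      by simp
    also have "\<dots> \<le> (SUP n. ennreal (g s) * indicator {s. f s + B < real n} s)"
      by (rule SUP_upper) simp
    finally show "ennreal (g s) \<le> \<dots>" .
  qed (auto intro!: SUP_least split: split_indicator)
  also have "\<dots> = (SUP n. \<integral>\<^sup>+s. ennreal (g s) * indicator {s. f s + B < real n} s \<partial>\<pi>)"
    by (intro nn_integral_monotone_convergence_SUP)
      (auto simp: incseq_def le_fun_def split: split_indicator)
  also have "\<dots> \<le> ennreal b"
    by (intro SUP_least trunc)
  finally have le: "(\<integral>\<^sup>+s. ennreal (g s) \<partial>\<pi>) \<le> ennreal b" .
  have int: "integrable (measure_pmf \<pi>) g"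
    using le g by (intro integrableI_bounded) (auto intro: le_less_trans)
  then have "ennreal (measure_pmf.expectation \<pi> g) \<le> ennreal b"
    using le g by (subst nn_integral_eq_integral[symmetric]) auto
  then show ?thesis
    using int \<open>0 \<le> b\<close> by (simp add: ennreal_le_iff)
qed

section \<open>Expectations over one chain-segment\<close>

context
  fixes p pE :: real
  assumes p: "0 < p" "p < 1" and pE: "0 < pE" "pE \<le> 1"
begin

lemma power_mem: "0 < (1 - p) ^ n" "(1 - p) ^ n \<le> 1" "0 \<le> (1 - pE) ^ n" "(1 - pE) ^ n \<le> 1"
  using p pE by (auto simp: power_le_one)

lemma power_Suc_less_1: "(1 - p) ^ Suc n < 1"
  using p by (intro power_Suc_less_one) auto

lemma integrable_chain_segment [simp]:
  "integrable (measure_pmf (chain_segment p pE s)) (f :: nat \<times> nat \<Rightarrow> real)"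
  by (rule integrable_measure_pmf_finite[OF finite_set_chain_segment])

text \<open>Conditions on the first search. The factors \<open>1 - (1 - p) ^ h\<close> and
  \<open>1 - (1 - pE) ^ e\<close> vanish at \<open>h = 0\<close> and \<open>e = 0\<close>, so the
  truncated subtractions are harmless.\<close>

lemma expectation_chain_segment:
  fixes f :: "nat \<times> nat \<Rightarrow> real"
  shows "measure_pmf.expectation (chain_segment p pE (h, e)) f =
    (1 - (1 - p) ^ h) * measure_pmf.expectation (chain_segment p pE (h - 1, e)) f +
    (1 - p) ^ h * ((1 - (1 - pE) ^ e) * measure_pmf.expectation (chain_segment p pE (h, e - 1)) f +
      (1 - pE) ^ e * f (h, e))"
  using p pE power_mem[of h] power_mem[of e]
  by (subst chain_segment.simps)
    (simp add: some_edge_eq_bernoulli expectation_bind_bernoulli finite_set_chain_segment)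

text \<open>Comparison principle: the true expectation satisfies the one-step recursion with
  equality, all weights are nonnegative, and every continued search removes a waiting agent, so
  induction on \<open>h + e\<close> keeps it below \<open>W\<close>.\<close>

lemma chain_segment_supersolution:
  fixes f :: "nat \<times> nat \<Rightarrow> real" and W :: "nat \<Rightarrow> nat \<Rightarrow> real"
  assumes W: "\<And>h e. (1 - (1 - p) ^ h) * W (h - 1) e +
      (1 - p) ^ h * ((1 - (1 - pE) ^ e) * W h (e - 1) + (1 - pE) ^ e * f (h, e)) \<le> W h e"
  shows "measure_pmf.expectation (chain_segment p pE (h, e)) f \<le> W h e"
proof (induction "h + e" arbitrary: h e rule: less_induct)
  case less
  let ?C = "\<lambda>h e. measure_pmf.expectation (chain_segment p pE (h, e)) f"
  have H: "(1 - (1 - p) ^ h) * ?C (h - 1) e \<le> (1 - (1 - p) ^ h) * W (h - 1) e"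
    using less[of "h - 1" e] power_mem[of h] by (cases h) (auto intro!: mult_left_mono)
  have E: "(1 - (1 - pE) ^ e) * ?C h (e - 1) \<le> (1 - (1 - pE) ^ e) * W h (e - 1)"
    using less[of h "e - 1"] power_mem[of e] by (cases e) (auto intro!: mult_left_mono)
  have "?C h e \<le> (1 - (1 - p) ^ h) * W (h - 1) e +
      (1 - p) ^ h * ((1 - (1 - pE) ^ e) * W h (e - 1) + (1 - pE) ^ e * f (h, e))"
    unfolding expectation_chain_segment[of h e]
    using power_mem[of h] by (intro add_mono[OF H] mult_left_mono[OF add_right_mono[OF E]]) simp
  then show ?case
    using W[of h e] by simp
qed

lemma chain_segment_e_le:
  "measure_pmf.expectation (chain_segment p pE (h, e)) (\<lambda>s. (real (snd s))\<^sup>2) \<le> (real e)\<^sup>2"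
proof -
  have "measure_pmf.expectation (chain_segment p pE (h, e)) (\<lambda>s. (real (snd s))\<^sup>2)
      \<le> measure_pmf.expectation (chain_segment p pE (h, e)) (\<lambda>_. (real e)\<^sup>2)"
    using set_chain_segment[of p pE h e]
    by (intro integral_mono_AE AE_pmfI) (auto intro!: power_mono)
  then show ?thesis by simp
qed

text \<open>When the segment leaves the level of \<open>j\<close> easy agents or stops there, it
  stops with conditional probability \<open>(1 - pE) ^ j\<close>. Hence it ends with
  \<open>j\<close> easy agents with at most this probability, whatever \<open>h\<close> is.\<close>

lemma chain_segment_e_square_bound:
  "measure_pmf.expectation (chain_segment p pE (h, e)) (\<lambda>s. (real (snd s))\<^sup>2)
    \<le> (\<Sum>j\<le>e. (1 - pE) ^ j * (real j)\<^sup>2)"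
proof (rule chain_segment_supersolution)
  fix h e
  show "(1 - (1 - p) ^ h) * (\<Sum>j\<le>e. (1 - pE) ^ j * (real j)\<^sup>2) +
      (1 - p) ^ h * ((1 - (1 - pE) ^ e) * (\<Sum>j\<le>e - 1. (1 - pE) ^ j * (real j)\<^sup>2) +
        (1 - pE) ^ e * (real (snd (h, e)))\<^sup>2) \<le> (\<Sum>j\<le>e. (1 - pE) ^ j * (real j)\<^sup>2)"
  proof (cases e)
    case (Suc n)
    define T where "T = (\<Sum>j\<le>n. (1 - pE) ^ j * (real j)\<^sup>2)"
    define c where "c = (1 - pE) ^ e"
    have T: "(\<Sum>j\<le>e. (1 - pE) ^ j * (real j)\<^sup>2) = T + c * (real e)\<^sup>2"
      by (simp add: Suc T_def c_def)
    have "0 \<le> c * T * (1 - p) ^ h"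
      using pE p unfolding c_def T_def by (intro mult_nonneg_nonneg sum_nonneg) auto
    then show ?thesis
      unfolding T c_def[symmetric] by (simp add: Suc algebra_simps flip: T_def)
  qed simp
qed

text \<open>The expected change of the test function in one step of the chain-segment is the probability of
  stopping there if \<open>h > 0\<close>, and nonpositive if \<open>h = 0\<close>; over the whole segment it is at most 1.\<close>

lemma chain_segment_reciprocal_bound:
  "measure_pmf.expectation (chain_segment p pE (h, e))
      (\<lambda>(h, e). real e - (\<Sum>k\<in>{1..h}. (1 - p) ^ k / (1 - (1 - p) ^ k)))
    \<le> real e - (\<Sum>k\<in>{1..h}. (1 - p) ^ k / (1 - (1 - p) ^ k)) + 1"
proof (rule chain_segment_supersolution, unfold prod.case)
  fix h e
  let ?F = "\<lambda>h. \<Sum>k\<in>{1..h}. (1 - p) ^ k / (1 - (1 - p) ^ k)"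
  define c where "c = (1 - pE) ^ e"
  \<comment> \<open>At \<open>e = 0\<close> the two sides differ only in a factor multiplied by
    \<open>1 - c = 0\<close>.\<close>
  have ce: "(1 - c) * real (e - 1) = (1 - c) * (real e - 1)"
    by (cases e) (auto simp: c_def)
  show "(1 - (1 - p) ^ h) * (real e - ?F (h - 1) + 1) + (1 - p) ^ h *
      ((1 - (1 - pE) ^ e) * (real (e - 1) - ?F h + 1) + (1 - pE) ^ e * (real e - ?F h))
      \<le> real e - ?F h + 1"
  proof (cases h)
    case 0
    then show ?thesis
      using ce unfolding c_def[symmetric] by (simp add: algebra_simps)
  next
    case (Suc n)
    define A where "A = (1 - p) ^ h"
    \<comment> \<open>The mean gain \<open>(1 - A) * R\<close> from removing a hard agent equals
      \<open>A\<close>. It exceeds the mean loss \<open>A * (1 - c)\<close> from removing an easy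
      one by \<open>A * c\<close>, the probability of stopping.\<close>
    define R where "R = A / (1 - A)"
    have "A < 1"
      unfolding A_def Suc by (rule power_Suc_less_1)
    then have "(1 - A) * R = A"
      by (simp add: R_def)
    moreover have "?F h = ?F n + R"
      by (simp add: Suc R_def A_def)
    ultimately have "(1 - A) * (real e - ?F n + 1) + A *
      ((1 - c) * (real e - 1) - (1 - c) * (?F h - 1) + c * (real e - ?F h))
      \<le> real e - ?F h + 1"
      by (simp add: algebra_simps)
    then show ?thesis
      unfolding ce[symmetric] using Suc by (simp add: algebra_simps A_def c_def)
  qed
qed

text \<open>If \<open>(1 - p) ^ h\<close> were constant along the segment, each search would change
  the test function in mean by \<open>- (1 - (1 - p) ^ h)\<close> times the probability of stopping,
  hence by \<open>- (1 - (1 - p) ^ h)\<close> in total. The term of order \<open>p\<close> pays for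
  the variation of this power as hard agents are removed.\<close>

lemma chain_segment_success_bound:
  assumes "p \<le> 1 / 2"
  shows "measure_pmf.expectation (chain_segment p pE (h, e))
      (\<lambda>(h, e). (\<Sum>k\<in>{1..h}. (1 - p) ^ k) - real e * (1 - (1 - p) ^ h))
    \<le> (\<Sum>k\<in>{1..h}. (1 - p) ^ k) - (real e + 1) * (1 - (1 - p) ^ h)
      + p * ((real e + 1) * (real e + 2))"
proof (rule chain_segment_supersolution, unfold prod.case)
  fix h e
  let ?G = "\<lambda>h. \<Sum>k\<in>{1..h}. (1 - p) ^ k"
  define c where "c = (1 - pE) ^ e"
  define x where "x = real e"
  have c: "0 \<le> c" "0 \<le> x"
    using pE by (auto simp: c_def x_def)
  have ce: "(1 - c) * X (real (e - 1)) = (1 - c) * X (x - 1)" for X :: "real \<Rightarrow> real"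
    by (cases e) (auto simp: c_def x_def)
  show "(1 - (1 - p) ^ h) * (?G (h - 1) - (real e + 1) * (1 - (1 - p) ^ (h - 1))
        + p * ((real e + 1) * (real e + 2))) +
      (1 - p) ^ h * ((1 - (1 - pE) ^ e) * (?G h - (real (e - 1) + 1) * (1 - (1 - p) ^ h)
        + p * ((real (e - 1) + 1) * (real (e - 1) + 2))) +
      (1 - pE) ^ e * (?G h - real e * (1 - (1 - p) ^ h)))
    \<le> ?G h - (real e + 1) * (1 - (1 - p) ^ h) + p * ((real e + 1) * (real e + 2))"
    unfolding c_def[symmetric]
      ce[where X = "\<lambda>y. ?G h - (y + 1) * (1 - (1 - p) ^ h) + p * ((y + 1) * (y + 2))"]
    unfolding x_def[symmetric]
  proof (cases h)
    case 0
    have "(1 - c) * (p * (x * (x + 1))) \<le> 1 * (p * ((x + 1) * (x + 2)))"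
      using c p power_mem[of e] by (intro mult_mono) (auto simp: c_def)
    then show "(1 - (1 - p) ^ h) * (?G (h - 1) - (x + 1) * (1 - (1 - p) ^ (h - 1))
        + p * ((x + 1) * (x + 2))) +
      (1 - p) ^ h * ((1 - c) * (?G h - (x - 1 + 1) * (1 - (1 - p) ^ h)
        + p * ((x - 1 + 1) * (x - 1 + 2))) + c * (?G h - x * (1 - (1 - p) ^ h)))
    \<le> ?G h - (x + 1) * (1 - (1 - p) ^ h) + p * ((x + 1) * (x + 2))"
      using 0 by (simp add: add.commute)
  next
    case (Suc n)
    define a where "a = (1 - p) ^ n"
    have A: "(1 - p) ^ h = (1 - p) * a"
      by (simp add: Suc a_def)
    have G: "?G h = ?G n + (1 - p) * a"
      by (simp add: Suc a_def)
    \<comment> \<open>The slack in the recursion. Easy removals and stopping lower the correction by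
      \<open>p * (x + 1) * (2 + c * x)\<close> in mean over these two cases, of total weight
      \<open>(1 - p) * a\<close>; removing a hard agent shifts the power by \<open>p * a\<close>, at
      a cost of \<open>p * a * (x + 1)\<close>. The assumption \<open>p \<le> 1 / 2\<close> enters
      as \<open>1 \<le> (1 - p) * 2\<close>.\<close>
    have "0 \<le> p * (x + 1) * a * ((1 - p) * (2 + c * x) - (1 - (1 - p) * a))"
    proof -
      have "1 \<le> (1 - p) * 2" "0 \<le> (1 - p) * (c * x)" "0 \<le> (1 - p) * a"
        using assms p c by (auto simp: a_def)
      then have "0 \<le> (1 - p) * (2 + c * x) - (1 - (1 - p) * a)"
        by (simp only: distrib_left)
      then show ?thesis
        using p c by (intro mult_nonneg_nonneg) (auto simp: a_def)
    qed
    also have "\<dots> = (?G n + (1 - p) * a - (x + 1) * (1 - (1 - p) * a) + p * ((x + 1) * (x + 2)))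
      - ((1 - (1 - p) * a) * (?G n - (x + 1) * (1 - a) + p * ((x + 1) * (x + 2))) +
      (1 - p) * a * ((1 - c) * (?G n + (1 - p) * a - (x - 1 + 1) * (1 - (1 - p) * a)
        + p * ((x - 1 + 1) * (x - 1 + 2))) + c * (?G n + (1 - p) * a - x * (1 - (1 - p) * a))))"
      by algebra
    finally show "(1 - (1 - p) ^ h) * (?G (h - 1) - (x + 1) * (1 - (1 - p) ^ (h - 1))
        + p * ((x + 1) * (x + 2))) +
      (1 - p) ^ h * ((1 - c) * (?G h - (x - 1 + 1) * (1 - (1 - p) ^ h)
        + p * ((x - 1 + 1) * (x - 1 + 2))) + c * (?G h - x * (1 - (1 - p) ^ h)))
    \<le> ?G h - (x + 1) * (1 - (1 - p) ^ h) + p * ((x + 1) * (x + 2))"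
      unfolding A G using Suc by (simp add: a_def)
  qed
qed

text \<open>With many hard agents waiting, a segment typically removes at least \<open>m\<close> of
  them: each of the first \<open>m\<close> searches misses all hard agents with probability at most
  \<open>(1 - p) ^ (h - m)\<close>. The induction on \<open>m\<close> conditions on the first
  search.\<close>

lemma chain_segment_h_bound:
  "measure_pmf.expectation (chain_segment p pE (h, e)) (\<lambda>s. real (fst s))
    \<le> real h - real m + (real m)\<^sup>2 * (1 - p) ^ (h - m)"
proof -
  let ?C = "\<lambda>h e. measure_pmf.expectation (chain_segment p pE (h, e)) (\<lambda>s. real (fst s))"
  have le: "?C h e \<le> real h" for h e
  proof -
    have "?C h e \<le> measure_pmf.expectation (chain_segment p pE (h, e)) (\<lambda>_. real h)"
      using set_chain_segment[of p pE h e] by (intro integral_mono_AE AE_pmfI) auto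
    then show ?thesis by simp
  qed
  show ?thesis
  proof (induction m arbitrary: h)
    case 0
    show ?case using le by simp
  next
    case (Suc m)
    define A where "A = (1 - p) ^ h"
    define B where "B = (1 - p) ^ (h - Suc m)"
    have A: "0 \<le> A" "A \<le> 1" and B: "A \<le> B" "0 \<le> B"
      using p by (auto simp: A_def B_def power_le_one intro!: power_decreasing)
    have rest: "(1 - (1 - pE) ^ e) * ?C h (e - 1) + (1 - pE) ^ e * real h \<le> real h"
    proof -
      have "(1 - (1 - pE) ^ e) * ?C h (e - 1) \<le> (1 - (1 - pE) ^ e) * real h"
        using le power_mem[of e] by (intro mult_left_mono) auto
      then show ?thesis by (simp add: algebra_simps)
    qed
    have first: "(1 - A) * ?C (h - 1) e \<le> (1 - A) * (real h - 1 - real m) + (real m)\<^sup>2 * B"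
    proof (cases h)
      case 0
      then show ?thesis using A_def B by simp
    next
      case h: (Suc n)
      have "(1 - A) * ?C (h - 1) e \<le> (1 - A) * (real h - 1 - real m + (real m)\<^sup>2 * B)"
        using Suc[of "h - 1"] A by (intro mult_left_mono) (auto simp: h B_def)
      also have "\<dots> \<le> (1 - A) * (real h - 1 - real m) + 1 * ((real m)\<^sup>2 * B)"
        unfolding distrib_left using A B by (intro add_left_mono mult_right_mono) auto
      finally show ?thesis by simp
    qed
    have "?C h e \<le> (1 - A) * (real h - 1 - real m) + (real m)\<^sup>2 * B + A * real h"
      unfolding expectation_chain_segment[of h e] A_def[symmetric] fst_conv
      using first rest A by (intro add_mono mult_left_mono) auto
    also have "\<dots> = real h - real (Suc m) + (real m)\<^sup>2 * B + A * (real m + 1)"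
      by (simp add: algebra_simps)
    \<comment> \<open>The coefficient \<open>real m + 1\<close> is enlarged to the difference of the
      consecutive squares of \<open>Suc m\<close> and \<open>m\<close>.\<close>
    also have "\<dots> \<le> real h - real (Suc m) + (real m)\<^sup>2 * B + B * (2 * real m + 1)"
      using B A by (intro add_left_mono mult_mono) auto
    also have "\<dots> = real h - real (Suc m) + (real (Suc m))\<^sup>2 * B"
      by (simp add: algebra_simps power2_eq_square)
    finally show ?case by (simp add: B_def)
  qed
qed

lemma expectation_jump_kernel:
  fixes f :: "nat \<times> nat \<Rightarrow> real"
  assumes "0 \<le> \<alpha>" "\<alpha> \<le> 1"
  shows "measure_pmf.expectation (jump_kernel \<alpha> p pE d (h, e)) f =
    \<alpha> * ((1 - (1 - p) ^ d) * measure_pmf.expectation (chain_segment p pE (h, e)) f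
      + (1 - p) ^ d * f (h + 1, e)) +
    (1 - \<alpha>) * ((1 - (1 - pE) ^ d) * measure_pmf.expectation (chain_segment p pE (h, e)) f
      + (1 - pE) ^ d * f (h, e + 1))"
  using p pE power_mem[of d] assms
  by (simp add: jump_kernel_def arrival_def expectation_bind_bernoulli finite_set_chain_segment
      some_edge_eq_bernoulli)

end

section \<open>Elementary bounds on series and exponentials\<close>

text \<open>The second derivative of the geometric series has coefficients
  \<open>(n + 1) * (n + 2)\<close>, which dominate the squares, and converges on the same
  disc.\<close>

lemma sum_power_mult_square_bounded:
  fixes z :: real
  assumes "0 \<le> z" "z < 1"
  obtains S where "0 \<le> S" "\<And>n. (\<Sum>j\<le>n. z ^ j * (real j)\<^sup>2) \<le> S"
proof -
  have "summable (\<lambda>n. diffs (diffs (\<lambda>_. 1 :: real)) n * z ^ n)"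
    by (rule termdiff_converges[where K = 1], use assms in simp,
        rule termdiff_converges[where K = 1]) (auto intro: summable_geometric)
  then have sm: "summable (\<lambda>n. z ^ n * (real n)\<^sup>2)"
    by (rule summable_comparison_test'[where N = 0])
      (use assms in \<open>auto simp: diffs_def power2_eq_square abs_mult mult.commute
        intro!: mult_left_mono mult_mono\<close>)
  show ?thesis
  proof
    show "0 \<le> (\<Sum>j. z ^ j * (real j)\<^sup>2)"
      using assms by (intro suminf_nonneg sm) auto
    show "(\<Sum>j\<le>n. z ^ j * (real j)\<^sup>2) \<le> (\<Sum>j. z ^ j * (real j)\<^sup>2)" for n
      using assms by (intro sum_le_suminf sm) auto
  qed
qed

lemma square_mult_exp_minus_le:
  assumes "0 \<le> (x :: real)"
  shows "x\<^sup>2 * exp (- x) \<le> 2"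
proof -
  have "x\<^sup>2 \<le> 2 * exp x"
    using exp_lower_Taylor_quadratic[OF assms] assms by simp
  then show ?thesis
    by (simp add: exp_minus divide_simps)
qed

section \<open>Stationary bounds for the number of hard agents\<close>

text \<open>A segment or a joining easy agent raises \<open>f\<close> by at most 1, while a joining
  hard agent lowers it by \<open>?r (Suc h)\<close>. The drift is thus at most
  \<open>1 - \<alpha> * u * (1 + ?r (Suc h))\<close>, and \<open>1 + ?r k\<close> is the reciprocal
  of \<open>1 - (1 - p) ^ k\<close> for \<open>k \<ge> 1\<close>.\<close>

lemma expectation_reciprocal_le:
  assumes p: "0 < p" "p < 1" and pE: "0 < pE" "pE \<le> 1"
    and \<alpha>: "0 < \<alpha>" "\<alpha> < 1"
    and inv: "\<pi> \<bind> jump_kernel \<alpha> p pE d = \<pi>"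
  shows "integrable (measure_pmf \<pi>) (\<lambda>s. 1 / (1 - (1 - p) ^ Suc (fst s)))"
    and "measure_pmf.expectation \<pi> (\<lambda>s. 1 / (1 - (1 - p) ^ Suc (fst s))) \<le> 1 / (\<alpha> * (1 - p) ^ d)"
proof -
  let ?r = "\<lambda>k. (1 - p) ^ k / (1 - (1 - p) ^ k)"
  define f where "f = (\<lambda>(h, e). real e - (\<Sum>k\<in>{1..h}. ?r k))"
  let ?C = "\<lambda>s. measure_pmf.expectation (chain_segment p pE s) f"
  define u where "u = (1 - p) ^ d"
  define v where "v = (1 - pE) ^ d"
  have u: "0 < u" "u \<le> 1" and v: "0 \<le> v" "v \<le> 1"
    using p pE by (auto simp: u_def v_def power_le_one)
  have y: "p \<le> 1 - (1 - p) ^ k" if "k \<ge> 1" for k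
    using power_decreasing[OF that, of "1 - p"] p by simp
  have r0: "0 \<le> ?r k" for k
    using p by (intro divide_nonneg_nonneg) (auto simp: power_le_one)
  have r1: "0 \<le> \<alpha> * u * ?r (Suc k)" for k
    by (rule mult_nonneg_nonneg[OF _ r0]) (use u \<alpha> in simp)
  \<comment> \<open>One factor \<open>1 / p\<close> bounds the reciprocals of
    \<open>1 - (1 - p) ^ k\<close>, the other the geometric sum.\<close>
  have "- (1 / p / p) \<le> f s" for s
  proof (cases s)
    case (Pair h e)
    have "(\<Sum>k\<in>{1..h}. ?r k) \<le> (\<Sum>k\<in>{1..h}. (1 - p) ^ k / p)"
      using p y by (intro sum_mono divide_left_mono) (auto intro!: mult_pos_pos intro: less_le_trans)
    also have "\<dots> \<le> (\<Sum>k<Suc h. (1 - p) ^ k) / p"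
      unfolding sum_divide_distrib using p by (intro sum_mono2) auto
    also have "(\<Sum>k<Suc h. (1 - p) ^ k) \<le> 1 / p"
      using p by (subst sum_gp_strict) (auto simp: divide_simps power_le_one)
    finally have "(\<Sum>k\<in>{1..h}. ?r k) \<le> 1 / p / p"
      using p by (simp add: divide_right_mono)
    then show ?thesis
      by (simp add: f_def Pair)
  qed
  moreover have "0 \<le> \<alpha> * u * ?r (Suc (fst s))" for s :: "nat \<times> nat"
    by (rule r1)
  moreover have "0 \<le> 1 - \<alpha> * u"
    using u \<alpha> by (simp add: mult_le_one)
  moreover have "measure_pmf.expectation (jump_kernel \<alpha> p pE d s) f
      \<le> f s - \<alpha> * u * ?r (Suc (fst s)) + (1 - \<alpha> * u)" for s
  proof (cases s)
    case (Pair h e)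
    have C: "?C (h, e) \<le> f (h, e) + 1"
      using chain_segment_reciprocal_bound[OF p pE, of h e] unfolding f_def by simp
    have "measure_pmf.expectation (jump_kernel \<alpha> p pE d s) f =
        \<alpha> * ((1 - u) * ?C (h, e) + u * f (h + 1, e)) + (1 - \<alpha>) * ((1 - v) * ?C (h, e) + v * f (h, e + 1))"
      unfolding Pair u_def v_def using \<alpha> by (intro expectation_jump_kernel p pE) auto
    also have "\<dots> \<le> \<alpha> * ((1 - u) * (f (h, e) + 1) + u * f (h + 1, e)) +
        (1 - \<alpha>) * ((1 - v) * (f (h, e) + 1) + v * f (h, e + 1))"
      using C \<alpha> u v by (intro add_mono mult_left_mono) auto
    also have "f (h + 1, e) = f (h, e) - ?r (Suc h)"
      by (simp add: f_def)
    also have "f (h, e + 1) = f (h, e) + 1"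
      by (simp add: f_def)
    finally show ?thesis
      by (simp add: Pair algebra_simps)
  qed
  ultimately have "integrable (measure_pmf \<pi>) (\<lambda>s. \<alpha> * u * ?r (Suc (fst s))) \<and>
      measure_pmf.expectation \<pi> (\<lambda>s. \<alpha> * u * ?r (Suc (fst s))) \<le> 1 - \<alpha> * u"
    by (rule foster_bound[OF inv finite_set_jump_kernel])
  then have int: "integrable (measure_pmf \<pi>) (\<lambda>s. \<alpha> * u * ?r (Suc (fst s)))"
    and le: "measure_pmf.expectation \<pi> (\<lambda>s. \<alpha> * u * ?r (Suc (fst s))) \<le> 1 - \<alpha> * u"
    by blast+
  define g where "g = (\<lambda>s :: nat \<times> nat. \<alpha> * u * ?r (Suc (fst s)))"
  have eq: "1 / (1 - (1 - p) ^ Suc (fst s)) = 1 + 1 / (\<alpha> * u) * g s" for s :: "nat \<times> nat"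
    using y[of "Suc (fst s)"] p u \<alpha> by (simp add: g_def divide_simps)
  show "integrable (measure_pmf \<pi>) (\<lambda>s. 1 / (1 - (1 - p) ^ Suc (fst s)))"
    unfolding eq using int[folded g_def] by simp
  have "measure_pmf.expectation \<pi> (\<lambda>s. 1 / (1 - (1 - p) ^ Suc (fst s))) =
      1 + 1 / (\<alpha> * u) * measure_pmf.expectation \<pi> g"
    unfolding eq using int[folded g_def] by simp
  also have "\<dots> \<le> 1 + 1 / (\<alpha> * u) * (1 - \<alpha> * u)"
    using le[folded g_def] u \<alpha> by (intro add_left_mono mult_left_mono) auto
  also have "\<dots> = 1 / (\<alpha> * u)"
    using u \<alpha> by (simp add: field_simps)
  finally show "measure_pmf.expectation \<pi> (\<lambda>s. 1 / (1 - (1 - p) ^ Suc (fst s))) \<le> 1 / (\<alpha> * (1 - p) ^ d)"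
    by (simp add: u_def)
qed

lemma quadratic_le:
  fixes x c k :: real
  shows "k * x - x\<^sup>2 + c \<le> k\<^sup>2 + c"
proof -
  have "0 \<le> (x - k / 2)\<^sup>2 + 3 / 4 * k\<^sup>2"
    by simp
  then show ?thesis
    by (simp add: power2_eq_square algebra_simps)
qed

text \<open>The drift of \<open>f1\<close> is at most \<open>\<alpha> - ?y h\<close> up to
  \<open>p\<close> times a quadratic in \<open>e\<close>. The scale \<open>\<kappa>\<close> gives
  \<open>\<kappa> * p * f2\<close> the leading drift \<open>- 2 * p * x^2\<close>, uniformly in
  \<open>h\<close>.\<close>

lemma expectation_success_le:
  assumes p: "0 < p" "p \<le> 1 / 2" and pE: "0 < pE" "pE \<le> 1"
    and \<alpha>: "0 < \<alpha>" "\<alpha> < 1"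
    and inv: "\<pi> \<bind> jump_kernel \<alpha> p pE d = \<pi>"
    and S: "0 \<le> S" "\<And>n. (\<Sum>j\<le>n. (1 - pE) ^ j * (real j)\<^sup>2) \<le> S"
    and \<kappa>: "\<kappa> * ((1 - \<alpha>) * (1 - (1 - pE) ^ d)) = 2" "0 < \<kappa>"
  shows "measure_pmf.expectation \<pi> (\<lambda>s. 1 - (1 - p) ^ fst s)
    \<le> \<alpha> + p * ((2 * \<kappa> + 3)\<^sup>2 + \<kappa> * (1 + S) + 2)"
proof -
  have p1: "p < 1" using p by simp
  let ?G = "\<lambda>h. \<Sum>k\<in>{1..h}. (1 - p) ^ k"
  let ?y = "\<lambda>h. 1 - (1 - p) ^ h"
  let ?c = "(2 * \<kappa> + 3)\<^sup>2 + \<kappa> * (1 + S) + 2"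
  define f1 where "f1 = (\<lambda>(h, e). ?G h - real e * ?y h)"
  define f2 where "f2 = (\<lambda>s :: nat \<times> nat. (real (snd s))\<^sup>2)"
  \<comment> \<open>The square of \<open>e\<close> makes \<open>f\<close> bounded below, and its negative drift absorbs the
    error of order \<open>p e^2\<close> in the drift of \<open>f1\<close>.\<close>
  define f where "f = (\<lambda>s. f1 s + \<kappa> * p * f2 s)"
  let ?C = "\<lambda>f s. measure_pmf.expectation (chain_segment p pE s) f"
  define u where "u = (1 - p) ^ d"
  define v where "v = (1 - pE) ^ d"
  have u: "0 < u" "u \<le> 1" and v: "0 \<le> v" "v \<le> 1"
    using p pE by (auto simp: u_def v_def power_le_one)
  have y: "0 \<le> ?y h" "?y h \<le> 1" for h
    using p by (auto simp: power_le_one)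
  have "- (1 / (\<kappa> * p)) \<le> f s" for s
  proof (cases s)
    case (Pair h e)
    have "0 \<le> ((\<kappa> * p * real e - 1)\<^sup>2 + \<kappa> * p * real e) / (\<kappa> * p)"
      using \<kappa> p by (intro divide_nonneg_nonneg add_nonneg_nonneg) auto
    also have "\<dots> = \<kappa> * p * (real e)\<^sup>2 - real e + 1 / (\<kappa> * p)"
      using \<kappa> p by (simp add: field_simps power2_eq_square)
    finally have "- (1 / (\<kappa> * p)) \<le> \<kappa> * p * (real e)\<^sup>2 - real e" by simp
    also have "\<dots> \<le> \<kappa> * p * (real e)\<^sup>2 - real e * ?y h + ?G h"
      using y[of h] p by (intro add_increasing2 diff_left_mono mult_left_le sum_nonneg) auto
    finally show ?thesis
      by (simp add: f_def f1_def f2_def Pair)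
  qed
  moreover have "0 \<le> ?y (fst s)" for s :: "nat \<times> nat"
    by (rule y)
  moreover have "0 \<le> \<alpha> + p * ?c"
    using \<alpha> p S \<kappa> by (intro add_nonneg_nonneg mult_nonneg_nonneg) auto
  moreover have "measure_pmf.expectation (jump_kernel \<alpha> p pE d s) f
      \<le> f s - ?y (fst s) + (\<alpha> + p * ?c)" for s
  proof (cases s)
    case (Pair h e)
    define x where "x = real e"
    have x: "0 \<le> x" by (simp add: x_def)
    have C1: "?C f1 (h, e) \<le> f1 (h, e) - ?y h + p * ((x + 1) * (x + 2))"
      using chain_segment_success_bound[OF p(1) p1 pE p(2), of h e]
      unfolding f1_def x_def by (simp add: algebra_simps)
    have C2: "?C f2 (h, e) \<le> x\<^sup>2"
      unfolding f2_def x_def by (rule chain_segment_e_le[OF p(1) p1 pE])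
    have C2': "?C f2 (h, e) \<le> S"
      unfolding f2_def by (rule order_trans[OF chain_segment_e_square_bound[OF p(1) p1 pE] S(2)])
    have J: "measure_pmf.expectation (jump_kernel \<alpha> p pE d s) g =
        \<alpha> * ((1 - u) * ?C g (h, e) + u * g (h + 1, e)) + (1 - \<alpha>) * ((1 - v) * ?C g (h, e) + v * g (h, e + 1))"
      for g :: "nat \<times> nat \<Rightarrow> real"
      unfolding Pair u_def v_def using \<alpha> by (intro expectation_jump_kernel p p1 pE) auto
    have J1: "measure_pmf.expectation (jump_kernel \<alpha> p pE d s) f1
        \<le> f1 s + \<alpha> - ?y h + p * ((x + 1) * (x + 2))"
    proof -
      define w where "w = p * ((x + 1) * (x + 2))"
      have w: "0 \<le> w" using x p by (simp add: w_def)
      have "f1 (h + 1, e) = f1 (h, e) + (1 - p) * (1 - p) ^ h - x * (p * (1 - p) ^ h)"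
        by (simp add: f1_def x_def algebra_simps)
      also have "\<dots> \<le> f1 (h, e) + 1 * (1 - p) ^ h - 0"
        using x p by (intro diff_mono add_left_mono mult_right_mono) auto
      finally have join: "f1 (h + 1, e) \<le> f1 (h, e) + (1 - ?y h) + w"
        using w by simp
      \<comment> \<open>For hard arrivals the decrease after a match is weakened to the bound for
        joining. Both outcomes then contribute \<open>1 - ?y h\<close> with weight
        \<open>\<alpha>\<close>, easy arrivals \<open>- ?y h\<close> with weight
        \<open>1 - \<alpha>\<close>, in total \<open>\<alpha> - ?y h\<close>.\<close>
      have C: "?C f1 (h, e) \<le> f1 (h, e) + (1 - ?y h) + w"
        using C1 y[of h] unfolding w_def[symmetric] by linarith
      have join': "f1 (h, e + 1) \<le> f1 (h, e) - ?y h + w"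
        using w by (simp add: f1_def algebra_simps)
      have "measure_pmf.expectation (jump_kernel \<alpha> p pE d s) f1 \<le>
          \<alpha> * ((1 - u) * (f1 (h, e) + (1 - ?y h) + w) + u * (f1 (h, e) + (1 - ?y h) + w)) +
          (1 - \<alpha>) * ((1 - v) * (f1 (h, e) - ?y h + w) + v * (f1 (h, e) - ?y h + w))"
        unfolding J using C join join' C1[folded w_def] \<alpha> u v by (intro add_mono mult_left_mono) auto
      also have "\<dots> = f1 s + \<alpha> - ?y h + w"
        unfolding Pair by (simp add: algebra_simps)
      finally show ?thesis
        unfolding w_def .
    qed
    \<comment> \<open>A matched easy arrival resets the mean of \<open>f2\<close> to at most
      \<open>S\<close>, whatever its previous value; this supplies the negative quadratic
      drift.\<close>
    have J2: "measure_pmf.expectation (jump_kernel \<alpha> p pE d s) f2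
        \<le> x\<^sup>2 + (2 * x + 1 + S) - (1 - \<alpha>) * (1 - v) * x\<^sup>2"
    proof -
      have "measure_pmf.expectation (jump_kernel \<alpha> p pE d s) f2 \<le>
          \<alpha> * ((1 - u) * x\<^sup>2 + u * x\<^sup>2) + (1 - \<alpha>) * ((1 - v) * S + v * (x\<^sup>2 + (2 * x + 1)))"
        unfolding J using C2 C2' \<alpha> u v
        by (intro add_mono mult_left_mono) (auto simp: f2_def x_def power2_eq_square algebra_simps)
      also have "\<dots> = x\<^sup>2 - (1 - \<alpha>) * (1 - v) * x\<^sup>2 + (1 - \<alpha>) * (1 - v) * S + (1 - \<alpha>) * v * (2 * x + 1)"
        by (simp add: algebra_simps)
      also have "\<dots> \<le> x\<^sup>2 - (1 - \<alpha>) * (1 - v) * x\<^sup>2 + 1 * S + 1 * (2 * x + 1)"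
        using \<alpha> v S x by (intro add_mono mult_right_mono mult_le_one order_refl) auto
      finally show ?thesis by simp
    qed
    have lin: "measure_pmf.expectation (jump_kernel \<alpha> p pE d s) f =
        measure_pmf.expectation (jump_kernel \<alpha> p pE d s) f1 +
        \<kappa> * p * measure_pmf.expectation (jump_kernel \<alpha> p pE d s) f2"
      unfolding f_def
      by (subst Bochner_Integration.integral_add)
        (simp_all add: integrable_measure_pmf_finite finite_set_jump_kernel)
    also have "\<dots> \<le> (f1 s + \<alpha> - ?y h + p * ((x + 1) * (x + 2))) +
        \<kappa> * p * (x\<^sup>2 + (2 * x + 1 + S) - (1 - \<alpha>) * (1 - v) * x\<^sup>2)"
      using J1 J2 \<kappa> p by (intro add_mono mult_left_mono) auto
    also have "\<dots> = f s - ?y h + \<alpha> +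
        p * ((x + 1) * (x + 2) + \<kappa> * (2 * x + 1 + S) - (\<kappa> * ((1 - \<alpha>) * (1 - v))) * x\<^sup>2)"
      unfolding f_def f2_def Pair snd_conv x_def by (simp add: algebra_simps)
    \<comment> \<open>Of the drift \<open>- 2 * x^2\<close> one half cancels the square in the
      error, and the other half dominates the linear terms.\<close>
    also have "(x + 1) * (x + 2) + \<kappa> * (2 * x + 1 + S) - (\<kappa> * ((1 - \<alpha>) * (1 - v))) * x\<^sup>2 =
        (2 * \<kappa> + 3) * x - x\<^sup>2 + (\<kappa> * (1 + S) + 2)"
      unfolding \<kappa>(1)[folded v_def] by (simp add: algebra_simps power2_eq_square)
    also have "f s - ?y h + \<alpha> + p * \<dots> \<le> f s - ?y h + \<alpha> + p * ((2 * \<kappa> + 3)\<^sup>2 + (\<kappa> * (1 + S) + 2))"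
      using p by (intro add_left_mono mult_left_mono quadratic_le) auto
    finally show ?thesis
      by (simp add: Pair algebra_simps)
  qed
  ultimately show ?thesis
    by (rule foster_bound[OF inv finite_set_jump_kernel, THEN conjunct2])
qed

text \<open>A joining hard agent raises the cube of \<open>h\<close> by about
  \<open>3 * h^2\<close>, whereas an easy arrival is matched with a probability independent of
  \<open>p\<close> and for large \<open>h\<close> removes about \<open>m\<close> hard agents or more
  in mean. As \<open>m\<close> is chosen independently of \<open>p\<close>, the second moment of
  \<open>p * h\<close> is bounded uniformly.\<close>

lemma expectation_h_square_le:
  assumes p: "0 < p" "p < 1" and pE: "0 < pE" "pE \<le> 1"
    and \<alpha>: "0 < \<alpha>" "\<alpha> < 1"
    and inv: "\<pi> \<bind> jump_kernel \<alpha> p pE d = \<pi>"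
    and m: "9 \<le> (1 - \<alpha>) * (1 - (1 - pE) ^ d) * real m"
  shows "integrable (measure_pmf \<pi>) (\<lambda>s. (real (fst s))\<^sup>2)"
    and "measure_pmf.expectation \<pi> (\<lambda>s. (real (fst s))\<^sup>2) \<le> (1 + (real m)\<^sup>2 * exp (real m)) / p\<^sup>2"
proof -
  define f where "f = (\<lambda>s :: nat \<times> nat. (real (fst s)) ^ 3)"
  let ?C = "\<lambda>f s. measure_pmf.expectation (chain_segment p pE s) f"
  define b where "b = 1 + 2 * ((real m)\<^sup>2 * exp (real m) / p\<^sup>2)"
  define u where "u = (1 - p) ^ d"
  define v where "v = (1 - pE) ^ d"
  have u: "0 < u" "u \<le> 1" and v: "0 \<le> v" "v \<le> 1"
    using p pE by (auto simp: u_def v_def power_le_one)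
  define \<gamma> where "\<gamma> = (1 - \<alpha>) * (1 - v)"
  have \<gamma>: "0 \<le> \<gamma>" "\<gamma> \<le> 1" "9 \<le> \<gamma> * real m"
    using \<alpha> v m by (auto simp: \<gamma>_def v_def mult_le_one)
  \<comment> \<open>The power decays exponentially in \<open>p * h\<close>, which beats the square
    at the price of \<open>1 / p^2\<close>.\<close>
  have small: "x\<^sup>2 * (1 - p) ^ (h - m) \<le> 2 * exp (real m) / p\<^sup>2" if "x = real h" for x h
  proof -
    have "(1 - p) ^ (h - m) \<le> exp (- p) ^ (h - m)"
      using p exp_ge_add_one_self[of "- p"] by (intro power_mono) auto
    also have "\<dots> = exp (- p * real (h - m))"
      by (simp add: exp_of_nat_mult[symmetric] mult.commute)
    also have "\<dots> \<le> exp (real m - p * x)"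
    proof -
      have "p * x \<le> p * (real (h - m) + real m)"
        using p that by (intro mult_left_mono) auto
      also have "\<dots> \<le> p * real (h - m) + 1 * real m"
        unfolding distrib_left using p by (intro add_left_mono mult_right_mono) auto
      finally show ?thesis by simp
    qed
    finally have "x\<^sup>2 * (1 - p) ^ (h - m) \<le> x\<^sup>2 * exp (real m - p * x)"
      by (intro mult_left_mono) auto
    also have "\<dots> = exp (real m) / p\<^sup>2 * ((p * x)\<^sup>2 * exp (- (p * x)))"
      using p by (simp add: exp_diff exp_minus field_simps)
    also have "\<dots> \<le> exp (real m) / p\<^sup>2 * 2"
      using p that by (intro mult_left_mono square_mult_exp_minus_le) auto
    finally show ?thesis by (simp add: mult.commute)
  qed
  have "- 0 \<le> f s" for s
    by (simp add: f_def)
  moreover have "0 \<le> 2 * (real (fst s))\<^sup>2" for s :: "nat \<times> nat"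
    by simp
  moreover have "0 \<le> b"
    by (simp add: b_def)
  moreover have "measure_pmf.expectation (jump_kernel \<alpha> p pE d s) f
      \<le> f s - 2 * (real (fst s))\<^sup>2 + b" for s
  proof (cases s)
    case (Pair h e)
    define x where "x = real h"
    have x: "0 \<le> x" by (simp add: x_def)
    \<comment> \<open>The final number of hard agents is at most \<open>x\<close>, so its cube is at
      most \<open>x^2\<close> times the number itself; this reduces the cubic estimate to the linear
      one.\<close>
    have "?C f (h, e) \<le> ?C (\<lambda>s. x\<^sup>2 * real (fst s)) (h, e)"
      unfolding f_def x_def using set_chain_segment[of p pE h e]
      by (intro integral_mono_AE AE_pmfI integrable_chain_segment[OF p pE])
        (auto simp: power3_eq_cube power2_eq_square intro!: mult_mono)
    also have "\<dots> = x\<^sup>2 * ?C (\<lambda>s. real (fst s)) (h, e)"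
      by simp
    finally have Cx: "?C f (h, e) \<le> x\<^sup>2 * ?C (\<lambda>s. real (fst s)) (h, e)" .
    also have "\<dots> \<le> x\<^sup>2 * (x - real m + (real m)\<^sup>2 * (1 - p) ^ (h - m))"
      unfolding x_def by (intro mult_left_mono chain_segment_h_bound[OF p pE]) auto
    also have "\<dots> = x ^ 3 - real m * x\<^sup>2 + (real m)\<^sup>2 * (x\<^sup>2 * (1 - p) ^ (h - m))"
      by (simp add: algebra_simps power3_eq_cube power2_eq_square)
    also have "\<dots> \<le> x ^ 3 - real m * x\<^sup>2 + (real m)\<^sup>2 * (2 * exp (real m) / p\<^sup>2)"
      by (intro add_left_mono mult_left_mono small[OF x_def]) auto
    finally have C1: "?C f (h, e) \<le> x ^ 3 - real m * x\<^sup>2 + (b - 1)"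
      by (simp add: b_def mult.left_commute)
    have C2: "?C f (h, e) \<le> x ^ 3"
    proof -
      have "?C (\<lambda>s. real (fst s)) (h, e) \<le> x"
        using chain_segment_h_bound[OF p pE, of h e 0] by (simp add: x_def)
      then have "x\<^sup>2 * ?C (\<lambda>s. real (fst s)) (h, e) \<le> x\<^sup>2 * x"
        by (intro mult_left_mono) auto
      then show ?thesis
        using Cx by (simp add: power3_eq_cube power2_eq_square)
    qed
    define j where "j = (x + 1) ^ 3"
    have j: "j = x ^ 3 + (3 * x\<^sup>2 + 3 * x + 1)" "x ^ 3 \<le> j"
      using x by (auto simp: j_def algebra_simps power3_eq_cube power2_eq_square)
    have "measure_pmf.expectation (jump_kernel \<alpha> p pE d s) f =
        \<alpha> * ((1 - u) * ?C f (h, e) + u * f (h + 1, e)) + (1 - \<alpha>) * ((1 - v) * ?C f (h, e) + v * f (h, e + 1))"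
      unfolding Pair u_def v_def using \<alpha> by (intro expectation_jump_kernel p pE) auto
    also have "\<dots> \<le> \<alpha> * ((1 - u) * j + u * j) +
        (1 - \<alpha>) * ((1 - v) * (x ^ 3 - real m * x\<^sup>2 + (b - 1)) + v * x ^ 3)"
      using C1 order_trans[OF C2 j(2)] \<alpha> u v
      by (intro add_mono mult_left_mono) (simp_all add: f_def x_def j_def add.commute)
    also have "\<dots> = x ^ 3 + \<alpha> * (3 * x\<^sup>2 + 3 * x + 1) - \<gamma> * real m * x\<^sup>2 + \<gamma> * (b - 1)"
      unfolding j(1) \<gamma>_def by (simp add: algebra_simps)
    \<comment> \<open>Since \<open>x \<le> x^2\<close> for natural numbers, the growth
      \<open>3 * x^2 + 3 * x\<close> is at most \<open>6 * x^2\<close>, and the constant 9 leaves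
      more than the required \<open>2 * x^2\<close>.\<close>
    also have "\<dots> \<le> x ^ 3 + 1 * (3 * x\<^sup>2 + 3 * x + 1) - 9 * x\<^sup>2 + 1 * (b - 1)"
      using \<alpha> \<gamma> x by (intro add_mono diff_mono mult_right_mono) (auto simp: b_def)
    also have "\<dots> \<le> x ^ 3 - 2 * x\<^sup>2 + b"
    proof -
      have "x \<le> x\<^sup>2"
        by (cases h) (auto simp: x_def power2_eq_square algebra_simps)
      then show ?thesis using x by simp
    qed
    finally show ?thesis
      by (simp add: Pair f_def x_def)
  qed
  ultimately have "integrable (measure_pmf \<pi>) (\<lambda>s. 2 * (real (fst s))\<^sup>2) \<and>
      measure_pmf.expectation \<pi> (\<lambda>s. 2 * (real (fst s))\<^sup>2) \<le> b"
    by (rule foster_bound[OF inv finite_set_jump_kernel])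
  then have int: "integrable (measure_pmf \<pi>) (\<lambda>s. 2 * (real (fst s))\<^sup>2)"
    and le: "measure_pmf.expectation \<pi> (\<lambda>s. 2 * (real (fst s))\<^sup>2) \<le> b"
    by blast+
  show "integrable (measure_pmf \<pi>) (\<lambda>s. (real (fst s))\<^sup>2)"
    using integrable_mult_right[OF int, of "1/2"] by simp
  have "measure_pmf.expectation \<pi> (\<lambda>s. (real (fst s))\<^sup>2) \<le> 1 / 2 + (real m)\<^sup>2 * exp (real m) / p\<^sup>2"
    using le by (simp add: b_def)
  also have "1 / 2 \<le> 1 / p\<^sup>2"
    using p power_le_one[of p 2] by (simp add: divide_simps)
  finally show "measure_pmf.expectation \<pi> (\<lambda>s. (real (fst s))\<^sup>2) \<le> (1 + (real m)\<^sup>2 * exp (real m)) / p\<^sup>2"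
    by (simp add: add_divide_distrib)
qed

section \<open>From concentration to the logarithm\<close>

text \<open>The numerator on the right-hand side is \<open>(y - \<alpha>)^2 / y\<close>, expanded so that its
  expectation is read off from those of \<open>y\<close> and \<open>1 / y\<close>.\<close>

lemma abs_deviation_le:
  fixes y \<eta> \<alpha> :: real
  assumes "0 < y" "y \<le> 1" "0 < \<eta>"
  shows "\<bar>y - \<alpha>\<bar> \<le> \<eta> + (y - 2 * \<alpha> + \<alpha>\<^sup>2 * (1 / y)) / \<eta>"
proof -
  have eq: "(y - \<alpha>)\<^sup>2 / y = y - 2 * \<alpha> + \<alpha>\<^sup>2 * (1 / y)"
    using assms by (simp add: field_simps power2_eq_square)
  have "2 * \<eta> * \<bar>y - \<alpha>\<bar> \<le> \<eta>\<^sup>2 + (y - \<alpha>)\<^sup>2"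
    using sum_squares_bound[of \<eta> "\<bar>y - \<alpha>\<bar>"] by simp
  moreover have "(y - \<alpha>)\<^sup>2 \<le> (y - \<alpha>)\<^sup>2 / y"
    using assms by (simp add: divide_simps mult_left_le)
  moreover have "0 \<le> \<eta> * \<bar>y - \<alpha>\<bar>"
    using assms by simp
  ultimately have "\<eta> * \<bar>y - \<alpha>\<bar> \<le> \<eta>\<^sup>2 + (y - \<alpha>)\<^sup>2 / y"
    by linarith
  then show ?thesis
    using assms unfolding eq by (simp add: field_simps power2_eq_square)
qed

text \<open>The lower bound is \<open>ln t \<le> t - 1\<close>. For the upper bound the logarithm is
  unbounded as \<open>a\<close> approaches 0, so it is cut at \<open>K\<close>: below,
  \<open>\<beta> / a\<close> is at most \<open>exp K\<close>; above, the logarithm is at most its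
  square over \<open>K\<close>, which a second moment controls.\<close>

lemma ln_ratio_bounds:
  fixes a \<beta> K :: real
  assumes "0 < a" "0 < \<beta>" "0 < K"
  shows "- \<bar>a - \<beta>\<bar> / \<beta> \<le> ln (\<beta> / a)"
    and "ln (\<beta> / a) \<le> exp K * \<bar>a - \<beta>\<bar> / \<beta> + (ln (\<beta> / a))\<^sup>2 / K"
proof -
  have "ln (a / \<beta>) \<le> a / \<beta> - 1"
    using assms by (intro ln_le_minus_one) simp
  also have "\<dots> = (a - \<beta>) / \<beta>"
    using assms by (simp add: field_simps)
  also have "\<dots> \<le> \<bar>a - \<beta>\<bar> / \<beta>"
    using assms by (intro divide_right_mono) auto
  finally show "- \<bar>a - \<beta>\<bar> / \<beta> \<le> ln (\<beta> / a)"
    using assms by (simp add: ln_div)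
next
  define z where "z = ln (\<beta> / a)"
  have ez: "\<beta> = a * exp z"
    using assms by (simp add: z_def)
  show "z \<le> exp K * \<bar>a - \<beta>\<bar> / \<beta> + z\<^sup>2 / K"
  proof (cases "z \<le> K")
    case True
    have "z \<le> (\<beta> - a) / a"
      using exp_ge_add_one_self[of z] assms by (simp add: ez diff_divide_distrib del: exp_ge_add_one_self)
    also have "\<dots> \<le> exp z * \<bar>a - \<beta>\<bar> / \<beta>"
      using assms by (simp add: ez divide_simps)
    also have "\<dots> \<le> exp K * \<bar>a - \<beta>\<bar> / \<beta>"
      using True assms by (intro divide_right_mono mult_right_mono) auto
    also have "\<dots> \<le> \<dots> + z\<^sup>2 / K"
      using assms by simp
    finally show ?thesis .
  next
    case False
    then have "z \<le> z\<^sup>2 / K"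
      using assms by (simp add: divide_simps power2_eq_square mult_left_mono)
    also have "\<dots> \<le> exp K * \<bar>a - \<beta>\<bar> / \<beta> + z\<^sup>2 / K"
      using assms by simp
    finally show ?thesis .
  qed
qed

text \<open>Integrates the two logarithmic bounds: \<open>\<delta>\<close> dominates the mean
  deviation of \<open>(1 - p) ^ Suc (fst s)\<close> from \<open>1 - \<alpha>\<close>, relative to
  \<open>1 - \<alpha>\<close>, and the last summand comes from the second moment.\<close>

lemma ln_success_expectation_bounds:
  fixes \<pi> :: "(nat \<times> nat) pmf"
  assumes p: "0 < p" "p \<le> 1 / 2" and \<alpha>: "0 < \<alpha>" "\<alpha> < 1" and C: "0 \<le> C"
    and reciprocal: "integrable (measure_pmf \<pi>) (\<lambda>s. 1 / (1 - (1 - p) ^ Suc (fst s)))"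
      "measure_pmf.expectation \<pi> (\<lambda>s. 1 / (1 - (1 - p) ^ Suc (fst s))) \<le> 1 / (\<alpha> * (1 - p) ^ d)"
    and success: "measure_pmf.expectation \<pi> (\<lambda>s. 1 - (1 - p) ^ fst s) \<le> \<alpha> + p * C"
    and square: "integrable (measure_pmf \<pi>) (\<lambda>s. (real (fst s))\<^sup>2)"
      "measure_pmf.expectation \<pi> (\<lambda>s. (real (fst s))\<^sup>2) \<le> M / p\<^sup>2"
    and K: "0 < K"
  defines "\<delta> \<equiv> 2 * sqrt (p * (C + 1) + \<alpha> * (1 / (1 - p) ^ d - 1)) / (1 - \<alpha>)"
    and "z \<equiv> ln (1 - \<alpha>) - ln (1 - p) * (measure_pmf.expectation \<pi> (\<lambda>s. real (fst s)) + 1)"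
  shows "integrable (measure_pmf \<pi>) (\<lambda>s. real (fst s))"
    and "- \<delta> \<le> z"
    and "z \<le> exp K * \<delta> + (2 * (ln (1 - \<alpha>))\<^sup>2 + 16 * M + 16) / K"
proof -
  let ?E = "measure_pmf.expectation \<pi>"
  have p1: "p < 1" using p by simp
  define a where "a = (\<lambda>s :: nat \<times> nat. (1 - p) ^ Suc (fst s))"
  define X where "X = (\<lambda>s :: nat \<times> nat. real (fst s))"
  have a: "0 < a s" "a s < 1" for s
    unfolding a_def using p1 p by (auto intro!: power_Suc_less_one simp del: power_Suc)
  have bounded: "integrable (measure_pmf \<pi>) f" if "\<And>s. 0 \<le> f s" "\<And>s. f s \<le> 1"
    for f :: "nat \<times> nat \<Rightarrow> real"
    using that by (intro measure_pmf.integrable_const_bound[where B = 1]) auto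
  have int_a: "integrable (measure_pmf \<pi>) a"
    using a by (intro bounded) (auto intro: less_imp_le)
  show int_X: "integrable (measure_pmf \<pi>) (\<lambda>s. real (fst s))"
  proof (rule Bochner_Integration.integrable_bound[OF square(1)])
    show "AE s in measure_pmf \<pi>. norm (real (fst s)) \<le> norm ((real (fst s))\<^sup>2)"
    proof (rule AE_pmfI)
      fix s :: "nat \<times> nat"
      show "norm (real (fst s)) \<le> norm ((real (fst s))\<^sup>2)"
        by (cases "fst s") (auto simp: power2_eq_square algebra_simps)
    qed
  qed simp
  \<comment> \<open>Bounds the mean of \<open>(y - \<alpha>)^2 / y\<close> for
    \<open>y = 1 - a s\<close>. Here \<open>C + 1\<close> replaces \<open>C\<close> because of the
    shift from \<open>fst s\<close> to \<open>Suc (fst s)\<close>, and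
    \<open>\<eta> = sqrt \<epsilon>\<close> minimizes
    \<open>\<eta> + \<epsilon> / \<eta>\<close>.\<close>
  define \<epsilon> where "\<epsilon> = p * (C + 1) + \<alpha> * (1 / (1 - p) ^ d - 1)"
  have "0 < \<epsilon>"
    unfolding \<epsilon>_def using p p1 C \<alpha>
    by (intro add_pos_nonneg mult_nonneg_nonneg) (auto simp: divide_simps power_le_one)
  define \<eta> where "\<eta> = sqrt \<epsilon>"
  have \<eta>: "0 < \<eta>" "\<eta> * \<eta> = \<epsilon>"
    using \<open>0 < \<epsilon>\<close> by (auto simp: \<eta>_def)
  have \<delta>: "\<delta> = 2 * \<eta> / (1 - \<alpha>)"
    by (simp add: \<delta>_def \<eta>_def \<epsilon>_def)
  define D where "D = (\<lambda>s. \<bar>a s - (1 - \<alpha>)\<bar>)"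
  have "D s \<le> 1" for s
    using a[of s] \<alpha> by (simp add: D_def abs_le_iff)
  then have int_D: "integrable (measure_pmf \<pi>) D"
    by (intro bounded) (auto simp: D_def)
  have D: "?E D \<le> 2 * \<eta>"
  proof -
    define Y where "Y = (\<lambda>s. 1 / (1 - a s))"
    have int_Y: "integrable (measure_pmf \<pi>) Y"
      using reciprocal(1) by (simp add: Y_def a_def)
    have "D s \<le> \<eta> + ((1 - a s) - 2 * \<alpha> + \<alpha>\<^sup>2 * Y s) / \<eta>" for s
    proof -
      have "D s = \<bar>(1 - a s) - \<alpha>\<bar>"
        unfolding D_def by linarith
      then show ?thesis
        using abs_deviation_le[of "1 - a s" \<eta> \<alpha>] a[of s] \<eta> by (simp add: Y_def)
    qed
    then have "?E D \<le> ?E (\<lambda>s. \<eta> + ((1 - a s) - 2 * \<alpha> + \<alpha>\<^sup>2 * Y s) / \<eta>)"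
      using int_D int_a int_Y by (intro integral_mono) auto
    also have "\<dots> = \<eta> + (1 - ?E a - 2 * \<alpha> + \<alpha>\<^sup>2 * ?E Y) / \<eta>"
      using int_a int_Y by simp
    also have "\<dots> \<le> \<eta> + \<epsilon> / \<eta>"
    proof -
      have "?E (\<lambda>s. 1 - a s) \<le> ?E (\<lambda>s. (1 - (1 - p) ^ fst s) + p)"
      proof (intro integral_mono Bochner_Integration.integrable_add)
        show "integrable (measure_pmf \<pi>) (\<lambda>s. 1 - (1 - p) ^ fst s)"
          using p p1 by (intro bounded) (auto simp: power_le_one)
        show "1 - a s \<le> 1 - (1 - p) ^ fst s + p" for s
        proof -
          have "p * (1 - p) ^ fst s \<le> p * 1"
            using p p1 by (intro mult_left_mono power_le_one) auto
          then show ?thesis by (simp add: a_def algebra_simps)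
        qed
      qed (use int_a in auto)
      also have "\<dots> = ?E (\<lambda>s. 1 - (1 - p) ^ fst s) + p"
      proof -
        have "integrable (measure_pmf \<pi>) (\<lambda>s. 1 - (1 - p) ^ fst s)"
          using p p1 by (intro bounded) (auto simp: power_le_one)
        then show ?thesis
          by (subst Bochner_Integration.integral_add) auto
      qed
      finally have "1 - ?E a \<le> \<alpha> + p * C + p"
        using success int_a by simp
      moreover have "\<alpha>\<^sup>2 * ?E Y \<le> \<alpha>\<^sup>2 * (1 / (\<alpha> * (1 - p) ^ d))"
        using reciprocal(2) unfolding Y_def a_def by (intro mult_left_mono) auto
      moreover have "\<alpha>\<^sup>2 * (1 / (\<alpha> * (1 - p) ^ d)) = \<alpha> * (1 / (1 - p) ^ d)"
        using \<alpha> by (simp add: power2_eq_square)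
      ultimately have "1 - ?E a - 2 * \<alpha> + \<alpha>\<^sup>2 * ?E Y \<le> \<epsilon>"
        unfolding \<epsilon>_def by (simp add: algebra_simps)
      then show ?thesis
        using \<eta> by (intro add_left_mono divide_right_mono) auto
    qed
    also have "\<epsilon> / \<eta> = \<eta>"
      using \<eta> by (simp add: field_simps)
    finally show ?thesis by simp
  qed
  \<comment> \<open>Since \<open>ln (a s)\<close> is linear in \<open>Suc (fst s)\<close>, the mean
    of \<open>Z\<close> is \<open>z\<close>, an affine function of the mean number of hard
    agents.\<close>
  define Z where "Z = (\<lambda>s. ln ((1 - \<alpha>) / a s))"
  have Z: "Z s = ln (1 - \<alpha>) - ln (1 - p) * (X s + 1)" for s
  proof -
    have "ln (a s) = real (Suc (fst s)) * ln (1 - p)"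
      unfolding a_def by (rule ln_realpow)
    then show ?thesis
      using a(1)[of s] \<alpha> by (simp add: Z_def X_def ln_div algebra_simps)
  qed
  have int_Z: "integrable (measure_pmf \<pi>) Z"
    unfolding Z X_def using int_X by simp
  have EZ: "?E Z = z"
    unfolding Z z_def X_def using int_X by simp
  have "- (?E D / (1 - \<alpha>)) = ?E (\<lambda>s. - D s / (1 - \<alpha>))"
    by simp
  also have "\<dots> \<le> ?E Z"
    using ln_ratio_bounds(1)[OF a(1) _ K, of "1 - \<alpha>"] \<alpha> int_D int_Z
    by (intro integral_mono) (auto simp: D_def Z_def)
  finally show "- \<delta> \<le> z"
    using D \<alpha> divide_right_mono[OF D, of "1 - \<alpha>"] unfolding EZ \<delta> by simp
  \<comment> \<open>The constants come from \<open>- ln (1 - p) \<le> 2 * p\<close> and two uses of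
    \<open>sq\<close>; the factor \<open>p^2\<close> later cancels the one in
    \<open>M / p^2\<close>.\<close>
  have Z2: "(Z s)\<^sup>2 \<le> 2 * (ln (1 - \<alpha>))\<^sup>2 + 16 * p\<^sup>2 * ((X s)\<^sup>2 + 1)" for s
  proof -
    have "- ln (1 - p) = ln (1 / (1 - p))"
      using p1 by (simp add: ln_div)
    also have "\<dots> \<le> 1 / (1 - p) - 1"
      using p1 by (intro ln_le_minus_one) simp
    also have "\<dots> \<le> 2 * p"
      using p p1 by (simp add: divide_simps algebra_simps)
    finally have ln2: "- ln (1 - p) \<le> 2 * p" .
    have "0 \<le> X s" by (simp add: X_def)
    have ln0: "ln (1 - p) \<le> 0"
      using p p1 by simp
    have sq: "(u + v)\<^sup>2 \<le> 2 * u\<^sup>2 + 2 * v\<^sup>2" for u v :: real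
      using sum_squares_bound[of u v] by (simp add: power2_sum)
    have "(Z s)\<^sup>2 \<le> 2 * (ln (1 - \<alpha>))\<^sup>2 + 2 * (- ln (1 - p) * (X s + 1))\<^sup>2"
      using sq[of "ln (1 - \<alpha>)" "- ln (1 - p) * (X s + 1)"] by (simp add: Z)
    also have "(- ln (1 - p) * (X s + 1))\<^sup>2 \<le> (2 * p * (X s + 1))\<^sup>2"
      using ln2 ln0 \<open>0 \<le> X s\<close> by (intro power_mono mult_right_mono mult_nonneg_nonneg) auto
    also have "\<dots> = 4 * p\<^sup>2 * (X s + 1)\<^sup>2"
      by (simp add: power_mult_distrib)
    also have "\<dots> \<le> 4 * p\<^sup>2 * (2 * (X s)\<^sup>2 + 2)"
      using sq[of "X s" 1] by (intro mult_left_mono) auto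
    finally show ?thesis by (simp add: algebra_simps)
  qed
  have int_X2: "integrable (measure_pmf \<pi>) (\<lambda>s. (X s)\<^sup>2)"
    using square(1) by (simp add: X_def)
  have int_Z2: "integrable (measure_pmf \<pi>) (\<lambda>s. (Z s)\<^sup>2)"
  proof (rule Bochner_Integration.integrable_bound)
    show "integrable (measure_pmf \<pi>) (\<lambda>s. 2 * (ln (1 - \<alpha>))\<^sup>2 + 16 * p\<^sup>2 * ((X s)\<^sup>2 + 1))"
      using int_X2 by simp
    show "AE s in measure_pmf \<pi>. norm ((Z s)\<^sup>2)
        \<le> norm (2 * (ln (1 - \<alpha>))\<^sup>2 + 16 * p\<^sup>2 * ((X s)\<^sup>2 + 1))"
      using Z2 by (intro AE_pmfI) (auto intro: order_trans)
  qed simp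
  have EZ2: "?E (\<lambda>s. (Z s)\<^sup>2) \<le> 2 * (ln (1 - \<alpha>))\<^sup>2 + 16 * M + 16"
  proof -
    have "?E (\<lambda>s. (Z s)\<^sup>2) \<le> ?E (\<lambda>s. 2 * (ln (1 - \<alpha>))\<^sup>2 + 16 * p\<^sup>2 * ((X s)\<^sup>2 + 1))"
      using int_X2 int_Z2 Z2 by (intro integral_mono) auto
    also have "\<dots> = 2 * (ln (1 - \<alpha>))\<^sup>2 + 16 * p\<^sup>2 * (?E (\<lambda>s. (X s)\<^sup>2) + 1)"
      using int_X2 by simp
    also have "\<dots> \<le> 2 * (ln (1 - \<alpha>))\<^sup>2 + 16 * p\<^sup>2 * (M / p\<^sup>2 + 1)"
      using square(2) by (intro add_left_mono mult_left_mono add_right_mono) (auto simp: X_def)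
    also have "\<dots> = 2 * (ln (1 - \<alpha>))\<^sup>2 + 16 * M + 16 * p\<^sup>2"
      using p by (simp add: field_simps)
    also have "\<dots> \<le> 2 * (ln (1 - \<alpha>))\<^sup>2 + 16 * M + 16"
      using p p1 by (simp add: power_le_one)
    finally show ?thesis .
  qed
  have "?E Z \<le> ?E (\<lambda>s. exp K * D s / (1 - \<alpha>) + (Z s)\<^sup>2 / K)"
    using ln_ratio_bounds(2)[OF a(1) _ K, of "1 - \<alpha>"] \<alpha> int_D int_Z int_Z2
    by (intro integral_mono) (auto simp: D_def Z_def)
  also have "\<dots> = exp K * (?E D / (1 - \<alpha>)) + ?E (\<lambda>s. (Z s)\<^sup>2) / K"
    using int_D int_Z2 by simp
  also have "\<dots> \<le> exp K * (2 * \<eta> / (1 - \<alpha>)) + (2 * (ln (1 - \<alpha>))\<^sup>2 + 16 * M + 16) / K"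
    using D EZ2 K \<alpha> by (intro add_mono mult_left_mono divide_right_mono) auto
  finally show "z \<le> exp K * \<delta> + (2 * (ln (1 - \<alpha>))\<^sup>2 + 16 * M + 16) / K"
    unfolding EZ \<delta> .
qed

section \<open>The limit as \<open>p\<close> tends to 0\<close>

text \<open>The constants \<open>S\<close>, \<open>\<kappa>\<close>, \<open>C\<close>,
  \<open>m\<close> and \<open>M\<close> do not depend on \<open>p\<close>, so \<open>p\<close> may
  tend to 0 for fixed \<open>K\<close>, which makes \<open>\<delta>\<close> vanish; a large
  \<open>K\<close> then handles the remaining term.\<close>

lemma tendsto_scaled_expectation:
  fixes \<pi> :: "real \<Rightarrow> (nat \<times> nat) pmf"
  assumes pE: "0 < pE" "pE \<le> 1" and d: "d \<ge> 1" and \<alpha>: "0 < \<alpha>" "\<alpha> < 1"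
    and inv: "\<And>p. 0 < p \<Longrightarrow> p < 1 \<Longrightarrow> \<pi> p \<bind> jump_kernel \<alpha> p pE d = \<pi> p"
  shows "\<forall>\<^sub>F p in at_right 0. integrable (measure_pmf (\<pi> p)) (\<lambda>s. real (fst s))"
    and "((\<lambda>p. p * measure_pmf.expectation (\<pi> p) (\<lambda>s. real (fst s))) \<longlongrightarrow> - ln (1 - \<alpha>)) (at_right 0)"
proof -
  have "(1 - pE) ^ d < 1"
    using power_decreasing[of 1 d "1 - pE"] pE d by auto
  then have q: "0 < (1 - \<alpha>) * (1 - (1 - pE) ^ d)"
    using \<alpha> by simp
  obtain S where S: "0 \<le> S" "\<And>n. (\<Sum>j\<le>n. (1 - pE) ^ j * (real j)\<^sup>2) \<le> S"
    using sum_power_mult_square_bounded[of "1 - pE"] pE by auto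
  define \<kappa> where "\<kappa> = 2 / ((1 - \<alpha>) * (1 - (1 - pE) ^ d))"
  have \<kappa>: "\<kappa> * ((1 - \<alpha>) * (1 - (1 - pE) ^ d)) = 2" "0 < \<kappa>"
    using q unfolding \<kappa>_def by (metis nonzero_eq_divide_eq less_irrefl, simp)
  define C where "C = (2 * \<kappa> + 3)\<^sup>2 + \<kappa> * (1 + S) + 2"
  have C: "0 \<le> C"
    using \<kappa> S by (simp add: C_def)
  obtain m :: nat where "9 / ((1 - \<alpha>) * (1 - (1 - pE) ^ d)) \<le> real m"
    using real_arch_simple by blast
  then have m: "9 \<le> (1 - \<alpha>) * (1 - (1 - pE) ^ d) * real m"
    using q by (simp add: pos_divide_le_eq mult.commute)
  define M where "M = 1 + (real m)\<^sup>2 * exp (real m)"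
  let ?E = "\<lambda>p. measure_pmf.expectation (\<pi> p) (\<lambda>s. real (fst s))"
  define \<delta> where "\<delta> = (\<lambda>p. 2 * sqrt (p * (C + 1) + \<alpha> * (1 / (1 - p) ^ d - 1)) / (1 - \<alpha>))"
  define z where "z = (\<lambda>p. ln (1 - \<alpha>) - ln (1 - p) * (?E p + 1))"
  define M2 where "M2 = 2 * (ln (1 - \<alpha>))\<^sup>2 + 16 * M + 16"
  have small: "\<forall>\<^sub>F p in at_right 0. 0 < p \<and> p < (1 / 2 :: real)"
    by (auto intro: eventually_at_rightI[of 0 "1 / 2"])
  have bounds: "integrable (measure_pmf (\<pi> p)) (\<lambda>s. real (fst s)) \<and> - \<delta> p \<le> z p \<and>
      z p \<le> exp K * \<delta> p + M2 / K" if "0 < p" "p < 1 / 2" "0 < K" for p K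
  proof -
    have p: "0 < p" "p \<le> 1 / 2" "p < 1"
      using that by auto
    note inv = inv[OF p(1,3)]
    note bounds = ln_success_expectation_bounds[OF p(1,2) \<alpha> C
        expectation_reciprocal_le[OF p(1,3) pE \<alpha> inv]
        expectation_success_le[OF p(1,2) pE \<alpha> inv S \<kappa>, folded C_def]
        expectation_h_square_le[OF p(1,3) pE \<alpha> inv m, folded M_def] \<open>0 < K\<close>]
    show ?thesis
      using bounds unfolding \<delta>_def z_def M2_def by blast
  qed
  show "\<forall>\<^sub>F p in at_right 0. integrable (measure_pmf (\<pi> p)) (\<lambda>s. real (fst s))"
    using small by eventually_elim (use bounds[where K = 1] in auto)
  have \<delta>0: "(\<delta> \<longlongrightarrow> 0) (at_right 0)"
  proof -
    have "(\<delta> \<longlongrightarrow> 2 * sqrt (0 * (C + 1) + \<alpha> * (1 / (1 - 0) ^ d - 1)) / (1 - \<alpha>)) (at_right 0)"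
      unfolding \<delta>_def by (intro tendsto_intros) (use \<alpha> in auto)
    then show ?thesis by simp
  qed
  have "0 \<le> M"
    by (simp add: M_def)
  then have "0 < M2"
    unfolding M2_def by (intro add_nonneg_pos add_nonneg_nonneg) auto
  have z0: "(z \<longlongrightarrow> 0) (at_right 0)"
  proof (rule order_tendstoI)
    fix r :: real assume "r < 0"
    have "((\<lambda>p. - \<delta> p) \<longlongrightarrow> - 0) (at_right 0)"
      by (intro tendsto_intros \<delta>0)
    then have "\<forall>\<^sub>F p in at_right 0. r < - \<delta> p"
      using \<open>r < 0\<close> by (intro order_tendstoD(1)) auto
    then show "\<forall>\<^sub>F p in at_right 0. r < z p"
      using small by eventually_elim (use bounds[where K = 1] in fastforce)
  next
    fix r :: real assume "0 < r"
    \<comment> \<open>This makes \<open>M2 / K\<close> equal to \<open>r / 2\<close>, leaving room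
      for the vanishing term \<open>exp K * \<delta> p\<close>.\<close>
    define K where "K = 2 * M2 / r"
    have K: "0 < K" "M2 / K < r"
      using \<open>0 < M2\<close> \<open>0 < r\<close> by (auto simp: K_def)
    have "((\<lambda>p. exp K * \<delta> p + M2 / K) \<longlongrightarrow> exp K * 0 + M2 / K) (at_right 0)"
      by (intro tendsto_intros \<delta>0) (use K in auto)
    then have "\<forall>\<^sub>F p in at_right 0. exp K * \<delta> p + M2 / K < r"
      using K by (intro order_tendstoD(2)) auto
    then show "\<forall>\<^sub>F p in at_right 0. z p < r"
      using small by eventually_elim (use bounds[OF _ _ K(1)] in fastforce)
  qed
  have ratio: "((\<lambda>p. p / (- ln (1 - p))) \<longlongrightarrow> (1 :: real)) (at_right 0)"
    by real_asymp
  \<comment> \<open>Solves the definition of \<open>z\<close> for \<open>p * ?E p\<close>; the final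
    \<open>- p\<close> removes the extra 1 in \<open>?E p + 1\<close>.\<close>
  have "((\<lambda>p. p / (- ln (1 - p)) * (z p - ln (1 - \<alpha>)) - p) \<longlongrightarrow> 1 * (0 - ln (1 - \<alpha>)) - 0) (at_right 0)"
    by (intro tendsto_intros ratio z0)
  moreover have "\<forall>\<^sub>F p in at_right 0. p / (- ln (1 - p)) * (z p - ln (1 - \<alpha>)) - p = p * ?E p"
    using small
  proof eventually_elim
    case (elim p)
    have "ln (1 - p) < 0"
      using elim by simp
    then show ?case
      by (simp add: z_def field_simps)
  qed
  ultimately show "((\<lambda>p. p * ?E p) \<longlongrightarrow> - ln (1 - \<alpha>)) (at_right 0)"
    by (simp add: tendsto_cong)
qed

section \<open>The scaled waiting time and its bound\<close>

theorem theorem3: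
  fixes lamH lamE pE :: real and d :: nat and \<pi> :: "real \<Rightarrow> (nat \<times> nat) pmf"
  assumes "lamH > 0" and "lamE > 0"
    and "0 < pE" and "pE \<le> 1"
    and "d \<ge> 1"
    and "\<And>pH. 0 < pH \<Longrightarrow> pH < 1 \<Longrightarrow>
           stationary_distribution (chainmatch_generator lamH lamE pH pE d) (\<pi> pH)"
  shows "\<exists>L. ((\<lambda>pH. ennreal pH * waiting_time_H lamH (\<pi> pH)) \<longlongrightarrow> L) (at_right 0) \<and>
             L \<le> ennreal (ln (lamH / (lamE * (1 - (1 - pE) ^ d)) + 1) / lamH)"
proof (intro exI conjI)
  define \<alpha> where "\<alpha> = lamH / (lamH + lamE)"
  have \<alpha>: "0 < \<alpha>" "\<alpha> < 1"
    using assms by (auto simp: \<alpha>_def)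
  let ?E = "\<lambda>p. measure_pmf.expectation (\<pi> p) (\<lambda>s. real (fst s))"
  have inv: "\<pi> p \<bind> jump_kernel \<alpha> p pE d = \<pi> p" if "0 < p" "p < 1" for p
    unfolding \<alpha>_def
    using stationary_distribution_imp_invariant[OF assms(1,2) assms(6)[OF that]] .
  have lim1: "\<forall>\<^sub>F p in at_right 0. integrable (measure_pmf (\<pi> p)) (\<lambda>s. real (fst s))"
    and lim2: "((\<lambda>p. p * ?E p) \<longlongrightarrow> - ln (1 - \<alpha>)) (at_right 0)"
    using tendsto_scaled_expectation[OF assms(3-5) \<alpha> inv] by auto
  \<comment> \<open>For small \<open>p\<close> integrability identifies the extended mean in the
    waiting time with the real expectation.\<close>
  have "\<forall>\<^sub>F p in at_right 0. ennreal (p * ?E p / lamH) = ennreal p * waiting_time_H lamH (\<pi> p)"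
    using lim1 eventually_at_right_less[of 0]
  proof eventually_elim
    case (elim p)
    have "(\<integral>\<^sup>+ s. of_nat (fst s) \<partial>measure_pmf (\<pi> p)) = (\<integral>\<^sup>+ s. ennreal (real (fst s)) \<partial>measure_pmf (\<pi> p))"
      by (simp add: ennreal_of_nat_eq_real_of_nat)
    also have "\<dots> = ennreal (?E p)"
      using elim by (intro nn_integral_eq_integral) auto
    finally have "waiting_time_H lamH (\<pi> p) = ennreal (?E p / lamH)"
      using assms(1) by (simp add: waiting_time_H_def divide_ennreal)
    then show ?case
      using elim by (simp flip: ennreal_mult')
  qed
  moreover have "((\<lambda>p. ennreal (p * ?E p / lamH)) \<longlongrightarrow> ennreal (- ln (1 - \<alpha>) / lamH)) (at_right 0)"
    using assms(1) by (intro tendsto_ennrealI tendsto_divide lim2 tendsto_const) auto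
  ultimately show "((\<lambda>p. ennreal p * waiting_time_H lamH (\<pi> p)) \<longlongrightarrow> ennreal (- ln (1 - \<alpha>) / lamH)) (at_right 0)"
    by (rule Lim_transform_eventually[rotated])
  have q: "0 < 1 - (1 - pE) ^ d" "1 - (1 - pE) ^ d \<le> 1"
    using assms(3-5) power_decreasing[of 1 d "1 - pE"] by auto
  have "- ln (1 - \<alpha>) = ln (1 / (1 - \<alpha>))"
    using \<alpha> by (simp add: ln_div)
  also have "1 / (1 - \<alpha>) = lamH / (lamE * 1) + 1"
    using assms(1,2) by (simp add: \<alpha>_def field_simps)
  \<comment> \<open>The limit has 1 where the claimed bound has
    \<open>1 - (1 - pE) ^ d \<le> 1\<close>, and a smaller denominator enlarges the
    fraction.\<close>
  also have "ln \<dots> \<le> ln (lamH / (lamE * (1 - (1 - pE) ^ d)) + 1)"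
    using assms(1,2) q
    by (subst ln_le_cancel_iff) (auto intro!: add_pos_pos divide_left_mono mult_pos_pos mult_left_le)
  finally show "ennreal (- ln (1 - \<alpha>) / lamH) \<le>
      ennreal (ln (lamH / (lamE * (1 - (1 - pE) ^ d)) + 1) / lamH)"
    using assms(1) by (intro ennreal_leI divide_right_mono) auto
qed

end
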